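(* Let $G$ and $H$ be finite non-abelian nilpotent groups such that the non-commuting graphs $\Gamma_G$ and $\Gamma_H$ are irregular and $\Gamma_G\cong\Gamma_H$ (as graphs). Then $|G|=|H|$.
   Context: For a non-abelian group $G$ with center $Z(G)$, the non-commuting graph $\Gamma_G$ is the simple graph with vertex set $G\setminus Z(G)$ in which two distinct vertices $x,y$ are adjacent if and only if $xy\neq yx$. A graph is regular if all its vertices have the same degree, and irregular otherwise. *)

theory Defs
  imports "HOL-Algebra.Algebra"
begin

definition center :: "('a, 'b) monoid_scheme \<Rightarrow> 'a set" where
  "center G = {z \<in> carrier G. \<forall>g \<in> carrier G. z \<otimes>\<^bsub>G\<^esub> g = g \<otimes>\<^bsub>G\<^esub> z}"

fun lower_central :: "('a, 'b) monoid_scheme \<Rightarrow> nat \<Rightarrow> 'a set" where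
  "lower_central G 0 = carrier G"
| "lower_central G (Suc n) = generate G
     {x \<otimes>\<^bsub>G\<^esub> y \<otimes>\<^bsub>G\<^esub> inv\<^bsub>G\<^esub> x \<otimes>\<^bsub>G\<^esub> inv\<^bsub>G\<^esub> y | x y.
        x \<in> lower_central G n \<and> y \<in> carrier G}"

definition nilpotent_group :: "('a, 'b) monoid_scheme \<Rightarrow> bool" where
  "nilpotent_group G \<longleftrightarrow> group G \<and> (\<exists>n. lower_central G n = {\<one>\<^bsub>G\<^esub>})"

definition nonabelian :: "('a, 'b) monoid_scheme \<Rightarrow> bool" where
  "nonabelian G \<longleftrightarrow> (\<exists>x \<in> carrier G. \<exists>y \<in> carrier G. x \<otimes>\<^bsub>G\<^esub> y \<noteq> y \<otimes>\<^bsub>G\<^esub> x)"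

definition nc_vertices :: "('a, 'b) monoid_scheme \<Rightarrow> 'a set" where
  "nc_vertices G = carrier G - center G"

definition nc_adj :: "('a, 'b) monoid_scheme \<Rightarrow> 'a \<Rightarrow> 'a \<Rightarrow> bool" where
  "nc_adj G x y \<longleftrightarrow> x \<in> nc_vertices G \<and> y \<in> nc_vertices G \<and> x \<noteq> y
      \<and> x \<otimes>\<^bsub>G\<^esub> y \<noteq> y \<otimes>\<^bsub>G\<^esub> x"

definition degree :: "'v set \<Rightarrow> ('v \<Rightarrow> 'v \<Rightarrow> bool) \<Rightarrow> 'v \<Rightarrow> nat" where
  "degree V E v = card {w \<in> V. E v w}"

definition regular_graph :: "'v set \<Rightarrow> ('v \<Rightarrow> 'v \<Rightarrow> bool) \<Rightarrow> bool" where
  "regular_graph V E \<longleftrightarrow> (\<forall>v \<in> V. \<forall>w \<in> V. degree V E v = degree V E w)"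

definition graph_iso :: "'v set \<Rightarrow> ('v \<Rightarrow> 'v \<Rightarrow> bool) \<Rightarrow> 'w set \<Rightarrow> ('w \<Rightarrow> 'w \<Rightarrow> bool) \<Rightarrow> bool" where
  "graph_iso V E W F \<longleftrightarrow> (\<exists>f. bij_betw f V W \<and> (\<forall>x \<in> V. \<forall>y \<in> V. E x y \<longleftrightarrow> F (f x) (f y)))"

end

theory Submission
  imports Defs "HOL-Number_Theory.Number_Theory" "Jordan_Normal_Form.Determinant"
begin

text \<open>
  A graph isomorphism identifies centralizers of sets of non-central elements, so the orders of all
  these centralizers, and of the groups, change by the same amount \<open>|Z(G)| - |Z(H)|\<close>. If \<open>G/Z(G)\<close> is
  not a prime power group, there are elements \<open>a\<close>, \<open>b\<close> with coprime non-trivial class sizes; as the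
  product formula \<open>|C(a)| |C(b)| = |G| |C(a) \<inter> C(b)|\<close> becomes an inequality in \<open>H\<close>, one gets
  \<open>|Z(G)| \<le> |Z(H)|\<close>, and \<open>H/Z(H)\<close> cannot be a prime power group either.

  If both central quotients are prime power groups, irregularity provides three relations
  \<open>|Z(G)| (p^i - 1) = |Z(H)| (q^j - 1)\<close>. Taking gcds, they amount to two different non-trivial
  solutions \<open>(x, y)\<close> of \<open>(P^x - 1)/(P - 1) = (Q^y - 1)/(Q - 1)\<close> with prime powers \<open>P\<close> and \<open>Q\<close>
  (Goormaghtigh's equation for fixed bases). For coprime \<open>P < Q\<close> this is impossible: the exponents of the
  minimal solution divide those of the other one after subtracting 1, the second solution is
  exponentially large by lifting the exponent, and \<open>P (Q - 1) P^(x - 1) \<equiv> Q - P\<close> modulo \<open>Q^y\<close> is then a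
  linear form in two logarithms that is too small \<open>Q\<close>-adically. This is ruled out by Schneider's method:
  pigeonhole yields an exponential polynomial all of whose values at integers are divisible
  by a high power of \<open>Q\<close>, so that it vanishes at many points, against a zero estimate. The finitely many
  cases where \<open>Q^(y - 1)\<close> is small are computed.
\<close>

hide_const (open) Divisibility.prime

section \<open>A zero estimate\<close>

text \<open>In the convolution for the top coefficient every index but one exceeds one of the two
  degree bounds. Bounds instead of exact degrees suit the Leibniz terms of a determinant, where the
  bounds of all columns add up to the same number for every permutation.\<close>

lemma coeff_prod_sum:
  fixes f :: "'i \<Rightarrow> 'a::comm_ring_1 poly"
  assumes "finite I" and "\<And>i. i \<in> I \<Longrightarrow> degree (f i) \<le> d i"
  shows "degree (\<Prod>i\<in>I. f i) \<le> (\<Sum>i\<in>I. d i)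
    \<and> coeff (\<Prod>i\<in>I. f i) (\<Sum>i\<in>I. d i) = (\<Prod>i\<in>I. coeff (f i) (d i))"
  using assms
proof (induction I rule: finite_induct)
  case (insert j I)
  have IH: "degree (\<Prod>i\<in>I. f i) \<le> (\<Sum>i\<in>I. d i)"
    "coeff (\<Prod>i\<in>I. f i) (\<Sum>i\<in>I. d i) = (\<Prod>i\<in>I. coeff (f i) (d i))"
    using insert by auto
  have dj: "degree (f j) \<le> d j" using insert by auto
  have "degree (f j * (\<Prod>i\<in>I. f i)) \<le> d j + (\<Sum>i\<in>I. d i)"
    using degree_mult_le[of "f j" "\<Prod>i\<in>I. f i"] dj IH(1) by linarith
  moreover have "coeff (f j * (\<Prod>i\<in>I. f i)) (d j + (\<Sum>i\<in>I. d i))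
      = coeff (f j) (d j) * coeff (\<Prod>i\<in>I. f i) (\<Sum>i\<in>I. d i)"
  proof -
    have "coeff (f j * (\<Prod>i\<in>I. f i)) (d j + (\<Sum>i\<in>I. d i))
      = (\<Sum>k\<le>d j + (\<Sum>i\<in>I. d i). coeff (f j) k * coeff (\<Prod>i\<in>I. f i) (d j + (\<Sum>i\<in>I. d i) - k))"
      by (simp add: coeff_mult)
    also have "\<dots> = (\<Sum>k\<in>{d j}. coeff (f j) k * coeff (\<Prod>i\<in>I. f i) (d j + (\<Sum>i\<in>I. d i) - k))"
    proof (rule sum.mono_neutral_right)
      show "\<forall>k\<in>{..d j + (\<Sum>i\<in>I. d i)} - {d j}. coeff (f j) k * coeff (\<Prod>i\<in>I. f i) (d j + (\<Sum>i\<in>I. d i) - k) = 0"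
      proof
        fix k assume "k \<in> {..d j + (\<Sum>i\<in>I. d i)} - {d j}"
        hence "k > d j \<or> d j + (\<Sum>i\<in>I. d i) - k > (\<Sum>i\<in>I. d i)" by auto
        thus "coeff (f j) k * coeff (\<Prod>i\<in>I. f i) (d j + (\<Sum>i\<in>I. d i) - k) = 0"
          using dj IH(1) by (auto simp: coeff_eq_0)
      qed
    qed auto
    finally show ?thesis by simp
  qed
  ultimately show ?case using insert IH(2) by simp
qed auto

text \<open>A vector in the kernel of the transpose would be the coefficient list of a nonzero
  polynomial of degree below \<open>w\<close> with the \<open>w\<close> distinct roots
  \<open>t i\<close>.\<close>

lemma det_vandermonde_ne_0:
  fixes t c :: "nat \<Rightarrow> 'a::field"
  assumes inj: "inj_on t {..<w}" and c: "\<And>i. i < w \<Longrightarrow> c i \<noteq> 0"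
  shows "det (mat w w (\<lambda>(s, i). c i * t i ^ s)) \<noteq> 0"
proof
  let ?N = "mat w w (\<lambda>(s, i). c i * t i ^ s)"
  assume "det ?N = 0"
  hence "det (transpose_mat ?N) = 0" by (subst det_transpose[of _ w]) auto
  then obtain v where v: "v \<in> carrier_vec w" "v \<noteq> 0\<^sub>v w" "transpose_mat ?N *\<^sub>v v = 0\<^sub>v w"
    using det_0_iff_vec_prod_zero_field[of "transpose_mat ?N" w] by auto
  define p where "p = (\<Sum>s<w. monom (v $ s) s)"
  have root: "poly p (t i) = 0" if i: "i < w" for i
  proof -
    have "0 = (transpose_mat ?N *\<^sub>v v) $ i" using v(3) i by simp
    also have "\<dots> = (\<Sum>s<w. c i * t i ^ s * v $ s)"
      using i v(1) by (simp add: scalar_prod_def atLeast0LessThan)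
    also have "\<dots> = c i * (\<Sum>s<w. v $ s * t i ^ s)" by (simp add: sum_distrib_left mult_ac)
    also have "(\<Sum>s<w. v $ s * t i ^ s) = poly p (t i)" by (simp add: p_def poly_sum poly_monom)
    finally show ?thesis using c[OF i] by simp
  qed
  have cf: "coeff p s = v $ s" if "s < w" for s
    using that by (simp add: p_def coeff_sum)
  have "p \<noteq> 0"
  proof
    assume "p = 0"
    hence "v = 0\<^sub>v w" using cf v(1) by (intro eq_vecI) auto
    with v(2) show False ..
  qed
  have "w > 0" using v(1,2) by (cases w) auto
  have "degree p \<le> w - 1"
    unfolding p_def by (rule degree_sum_le) (use \<open>w > 0\<close> in \<open>auto intro!: order.trans[OF degree_monom_le]\<close>)
  moreover have "card (t ` {..<w}) \<le> card {x. poly p x = 0}"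
    using root by (intro card_mono poly_roots_finite \<open>p \<noteq> 0\<close>) auto
  hence "w \<le> degree p"
    using card_poly_roots_bound[OF \<open>p \<noteq> 0\<close>] by (simp add: card_image[OF inj])
  ultimately show False using \<open>w > 0\<close> by linarith
qed

text \<open>
  For \<open>x \<in> Z\<close> the vector \<open>(y ^ l)\<close> lies in the kernel of a square matrix with polynomial entries in \<open>x\<close>.
  Its determinant is not zero because the leading coefficient is a Vandermonde determinant.
\<close>
lemma zero_estimate:
  fixes A :: "nat \<Rightarrow> real poly" and \<rho> u :: real
  assumes \<rho>: "0 < \<rho>" "\<rho> < 1" and S: "finite S"
    and A: "\<And>l. l \<in> S \<Longrightarrow> A l \<noteq> 0" "\<And>l. l \<in> S \<Longrightarrow> degree (A l) \<le> d"
    and Z: "\<And>x. x \<in> Z \<Longrightarrow> \<exists>y. y \<noteq> 0 \<and>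
      (\<forall>s < card S. (\<Sum>l\<in>S. poly (A l) (x + real s * u) * \<rho> ^ (l * s) * y ^ l) = 0)"
    and ne: "S \<noteq> {}"
  shows "finite Z \<and> card Z \<le> card S * d"
proof -
  define w where "w = card S"
  obtain e where e: "bij_betw e {..<w} S"
    using ex_bij_betw_nat_finite[OF S] by (auto simp: w_def atLeast0LessThan)
  have eS: "e i \<in> S" if "i < w" for i using e that by (auto simp: bij_betw_def)
  \<comment> \<open>Shifting the argument by \<open>s * u\<close> keeps degree and leading
    coefficient, so the degree bound of entry \<open>(s, i)\<close> depends on the column
    \<open>i\<close> only.\<close>
  define f where "f s i = pcompose (A (e i)) [:real s * u, 1:] * [:\<rho> ^ (e i * s):]" for s i
  define D where "D i = degree (A (e i))" for i
  define M where "M = mat w w (\<lambda>(s, i). f s i)"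
  have degf: "degree (f s i) \<le> D i" if "i < w" for s i
    using degree_mult_le[of "pcompose (A (e i)) [:real s * u, 1:]" "[:\<rho> ^ (e i * s):]"]
    by (simp add: f_def D_def degree_pcompose)
  have cff: "coeff (f s i) (D i) = lead_coeff (A (e i)) * (\<rho> ^ e i) ^ s" for s i
  proof -
    have "coeff (pcompose (A (e i)) [:real s * u, 1:]) (D i) = lead_coeff (A (e i))"
      using lead_coeff_comp[of "[:real s * u, 1:]" "A (e i)"] by (simp add: D_def degree_pcompose)
    thus ?thesis by (simp add: f_def power_mult)
  qed
  have detM: "det M = (\<Sum>p\<in>{p. p permutes {0..<w}}. signof p * (\<Prod>i = 0..<w. f i (p i)))"
    by (subst det_def'[of _ w]) (auto simp: M_def intro!: sum.cong prod.cong)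
  have permD: "(\<Sum>i = 0..<w. D (p i)) = (\<Sum>i = 0..<w. D i)" if "p permutes {0..<w}" for p
    using sum.permute[OF that, of D] by (simp add: o_def)
  have plt: "p i < w" if "p permutes {0..<w}" "i < w" for p i
    using permutes_in_image[OF that(1), of i] that(2) by simp
  \<comment> \<open>All Leibniz terms share one degree bound, so the coefficient of the determinant
    in that degree is the determinant of the leading coefficients.\<close>
  have one: "degree (\<Prod>i = 0..<w. f i (p i)) \<le> (\<Sum>i = 0..<w. D i)
      \<and> coeff (\<Prod>i = 0..<w. f i (p i)) (\<Sum>i = 0..<w. D i) = (\<Prod>i = 0..<w. coeff (f i (p i)) (D (p i)))"
    if p: "p permutes {0..<w}" for p
    using coeff_prod_sum[of "{0..<w}" "\<lambda>i. f i (p i)" "\<lambda>i. D (p i)"] degf plt[OF p] permD[OF p] by auto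
  have sgn: "(signof p :: real poly) = [:signof p:]" for p :: "nat \<Rightarrow> nat"
    by (simp add: sign_def one_pCons)
  have degM: "degree (det M) \<le> (\<Sum>i = 0..<w. D i)"
    unfolding detM
  proof (rule degree_sum_le)
    fix p assume "p \<in> {p. p permutes {0..<w}}"
    hence "degree (\<Prod>i = 0..<w. f i (p i)) \<le> (\<Sum>i = 0..<w. D i)" using one by auto
    thus "degree (signof p * (\<Prod>i = 0..<w. f i (p i))) \<le> (\<Sum>i = 0..<w. D i)"
      unfolding sgn using degree_mult_le[of "[:signof p:]" "\<Prod>i = 0..<w. f i (p i)"] by simp
  qed (auto intro: finite_permutations)
  have "coeff (det M) (\<Sum>i = 0..<w. D i)
      = (\<Sum>p\<in>{p. p permutes {0..<w}}. signof p * (\<Prod>i = 0..<w. coeff (f i (p i)) (D (p i))))"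
    unfolding detM coeff_sum by (intro sum.cong refl) (use one in \<open>auto simp: sgn\<close>)
  also have "\<dots> = det (mat w w (\<lambda>(s, i). lead_coeff (A (e i)) * (\<rho> ^ e i) ^ s))"
    by (subst det_def'[of _ w]) (auto simp: cff plt intro!: sum.cong prod.cong)
  also have "\<dots> \<noteq> 0"
  proof (rule det_vandermonde_ne_0)
    show "inj_on (\<lambda>i. \<rho> ^ e i) {..<w}"
    proof (rule inj_onI)
      fix i j assume ij: "i \<in> {..<w}" "j \<in> {..<w}" "\<rho> ^ e i = \<rho> ^ e j"
      have "e i = e j"
        using ij(3) \<rho> power_strict_decreasing[of "e i" "e j" \<rho>] power_strict_decreasing[of "e j" "e i" \<rho>]
        by (cases "e i" "e j" rule: linorder_cases) auto
      thus "i = j" using ij(1,2) e by (auto simp: bij_betw_def inj_on_def)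
    qed
  qed (use eS A in auto)
  finally have "det M \<noteq> 0" by auto
  have "poly (det M) x = 0" if x: "x \<in> Z" for x
  proof -
    obtain y where y: "y \<noteq> 0"
      "\<And>s. s < w \<Longrightarrow> (\<Sum>l\<in>S. poly (A l) (x + real s * u) * \<rho> ^ (l * s) * y ^ l) = 0"
      using Z[OF x] by (auto simp: w_def)
    interpret ev: comm_ring_hom "\<lambda>p :: real poly. poly p x" by unfold_locales auto
    have "poly (det M) x = det (map_mat (\<lambda>p. poly p x) M)" by simp
    moreover have "map_mat (\<lambda>p. poly p x) M *\<^sub>v vec w (\<lambda>i. y ^ e i) = 0\<^sub>v w"
    proof (rule eq_vecI)
      fix s assume "s < dim_vec (0\<^sub>v w :: real vec)"
      hence s: "s < w" by simp
      have "(map_mat (\<lambda>p. poly p x) M *\<^sub>v vec w (\<lambda>i. y ^ e i)) $ s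
          = (\<Sum>i<w. poly (A (e i)) (x + real s * u) * \<rho> ^ (e i * s) * y ^ e i)"
        using s by (simp add: M_def scalar_prod_def f_def poly_pcompose atLeast0LessThan add_ac mult.commute)
      also have "\<dots> = (\<Sum>l\<in>S. poly (A l) (x + real s * u) * \<rho> ^ (l * s) * y ^ l)"
        by (rule sum.reindex_bij_betw[OF e])
      finally show "(map_mat (\<lambda>p. poly p x) M *\<^sub>v vec w (\<lambda>i. y ^ e i)) $ s = 0\<^sub>v w $ s"
        using y(2)[OF s] s by simp
    qed (simp add: M_def)
    moreover have "vec w (\<lambda>i. y ^ e i) \<noteq> 0\<^sub>v w"
    proof
      assume *: "vec w (\<lambda>i. y ^ e i) = 0\<^sub>v w"
      have "0 < w" using ne S by (simp add: w_def card_gt_0_iff)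
      hence "vec w (\<lambda>i. y ^ e i) $ 0 = 0" using * by simp
      thus False using \<open>0 < w\<close> y(1) by simp
    qed
    moreover have "map_mat (\<lambda>p. poly p x) M \<in> carrier_mat w w" by (simp add: M_def)
    ultimately show ?thesis
      using det_0_iff_vec_prod_zero_field[of "map_mat (\<lambda>p. poly p x) M" w]
      by (metis vec_carrier)
  qed
  hence sub: "Z \<subseteq> {x. poly (det M) x = 0}" by auto
  have fin: "finite {x. poly (det M) x = 0}" using \<open>det M \<noteq> 0\<close> by (rule poly_roots_finite)
  have "card Z \<le> degree (det M)"
    using card_mono[OF fin sub] card_poly_roots_bound[OF \<open>det M \<noteq> 0\<close>] by linarith
  also have "\<dots> \<le> (\<Sum>i = 0..<w. D i)" by (rule degM)
  also have "\<dots> \<le> (\<Sum>i = 0..<w. d)" by (intro sum_mono) (use eS A in \<open>auto simp: D_def\<close>)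
  also have "\<dots> = card S * d" by (simp add: w_def)
  finally show ?thesis using finite_subset[OF sub fin] by simp
qed

section \<open>Linear forms in two logarithms\<close>

text \<open>Expanding \<open>((\<alpha> - 1) + 1) ^ (z - k)\<close> yields a combination of the
  \<open>z choose m\<close> whose coefficients do not depend on \<open>z\<close>. If
  \<open>Q\<close> divides \<open>\<alpha> - 1\<close>, they are divisible by
  \<open>Q ^ (m - k)\<close>, so only finitely many of them matter modulo a power of
  \<open>Q\<close>.\<close>

lemma binomial_power_expand:
  fixes \<alpha> :: "'a::comm_ring_1"
  shows "of_nat (z choose k) * \<alpha> ^ z
    = (\<Sum>m\<le>z. \<alpha> ^ k * of_nat (m choose k) * (\<alpha> - 1) ^ (m - k) * of_nat (z choose m))"
proof (cases "k \<le> z")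
  case True
  have "of_nat (z choose k) * \<alpha> ^ z = of_nat (z choose k) * \<alpha> ^ k * ((\<alpha> - 1) + 1) ^ (z - k)"
    using True by (simp add: mult.assoc flip: power_add)
  also have "\<dots> = of_nat (z choose k) * \<alpha> ^ k * (\<Sum>n\<le>z - k. of_nat ((z - k) choose n) * (\<alpha> - 1) ^ n)"
    by (subst binomial_ring) simp
  also have "\<dots> = (\<Sum>n\<le>z - k. \<alpha> ^ k * of_nat ((n + k) choose k) * (\<alpha> - 1) ^ n * of_nat (z choose (n + k)))"
    unfolding sum_distrib_left
  proof (intro sum.cong refl)
    fix n assume "n \<in> {..z - k}"
    hence "k \<le> n + k" "n + k \<le> z" using True by auto
    from choose_mult[OF this]
    have "(z choose (n + k)) * ((n + k) choose k) = (z choose k) * ((z - k) choose n)" by simp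
    hence "(of_nat (z choose (n + k)) * of_nat ((n + k) choose k) :: 'a)
        = of_nat (z choose k) * of_nat ((z - k) choose n)"
      by (simp flip: of_nat_mult)
    thus "of_nat (z choose k) * \<alpha> ^ k * (of_nat ((z - k) choose n) * (\<alpha> - 1) ^ n)
        = \<alpha> ^ k * of_nat ((n + k) choose k) * (\<alpha> - 1) ^ n * of_nat (z choose (n + k))"
      by (simp add: algebra_simps)
  qed
  also have "\<dots> = (\<Sum>m\<in>{k..z}. \<alpha> ^ k * of_nat (m choose k) * (\<alpha> - 1) ^ (m - k) * of_nat (z choose m))"
    by (rule sum.reindex_bij_witness[of _ "\<lambda>m. m - k" "\<lambda>n. n + k"]) (use True in auto)
  also have "\<dots> = (\<Sum>m\<le>z. \<alpha> ^ k * of_nat (m choose k) * (\<alpha> - 1) ^ (m - k) * of_nat (z choose m))"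
    by (rule sum.mono_neutral_left) (auto simp: not_le binomial_eq_0)
  finally show ?thesis .
qed (simp add: not_le binomial_eq_0)

text \<open>A form of Siegel's lemma. As \<open>Q ^ (m - b)\<close> always divides
  \<open>c m p\<close>, only the quotient modulo \<open>Q ^ (E - (m - b))\<close> has to be
  controlled, and only for \<open>m < b + E\<close>. Two vectors with entries in
  \<open>{0..<Q ^ h}\<close> share all these residues, and \<open>D\<close> is their
  difference.\<close>

lemma pigeonhole_coeffs:
  fixes c :: "nat \<Rightarrow> ('i \<Rightarrow> int) \<Rightarrow> int" and Q :: int
  assumes fin: "finite I" and Q: "Q \<ge> 2"
    and lin: "\<And>m p p'. c m (\<lambda>i. p i - p' i) = c m p - c m p'"
    and dv: "\<And>m p. Q ^ (m - b) dvd c m p"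
    and count: "E * (b + 1) + E * (E - 1) div 2 < h * card I"
  shows "\<exists>D. (\<exists>i\<in>I. D i \<noteq> 0) \<and> (\<forall>i. \<bar>D i\<bar> < Q ^ h) \<and> (\<forall>m. Q ^ E dvd c m D)"
proof -
  define \<P> where "\<P> = PiE I (\<lambda>_. {0..<Q ^ h})"
  define g where "g p i = (if i \<in> I then p i else 0)" for p :: "'i \<Rightarrow> int" and i
  define F where "F p = (\<lambda>m\<in>{..<b + E}. (c m (g p) div Q ^ (m - b)) mod Q ^ (E - (m - b)))" for p
  define T where "T = PiE {..<b + E} (\<lambda>m. {0..<Q ^ (E - (m - b))})"
  have finT: "finite T" by (auto simp: T_def intro!: finite_PiE)
  have FT: "F ` \<P> \<subseteq> T"
    using Q by (auto simp: F_def T_def split: if_splits)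
  have cP: "card \<P> = nat Q ^ (h * card I)"
    using fin Q by (simp add: \<P>_def card_PiE nat_power_eq power_mult)
  \<comment> \<open>The first \<open>b\<close> indices cost \<open>E\<close> digits in base
    \<open>Q\<close> each, the others \<open>E\<close>, \<open>E - 1\<close>, ..., 1.\<close>
  have "(\<Sum>m<b + E. E - (m - b)) = E * (b + 1) + E * (E - 1) div 2" if "E > 0"
  proof -
    have "(\<Sum>m<b + E. E - (m - b)) = (\<Sum>m<b. E - (m - b)) + (\<Sum>m=b..<b + E. E - (m - b))"
      by (simp add: sum.atLeastLessThan_concat[of 0 b "b+E", symmetric] flip: atLeast0LessThan)
    also have "(\<Sum>m<b. E - (m - b)) = b * E" by simp
    also have "(\<Sum>m=b..<b + E. E - (m - b)) = (\<Sum>d<E. E - d)"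
      by (rule sum.reindex_bij_witness[of _ "\<lambda>d. d + b" "\<lambda>m. m - b"]) auto
    also have "(\<Sum>d<E. E - d) = (\<Sum>d<E. Suc d)"
      by (rule sum.reindex_bij_witness[of _ "\<lambda>d. E - 1 - d" "\<lambda>d. E - 1 - d"]) auto
    also have "(\<Sum>d<E. Suc d) = E + E * (E - 1) div 2"
    proof (induction E)
      case (Suc n)
      have "even (n * (n - 1))" "even (n * Suc n)" by (cases n; simp)+
      then obtain i j where "n * (n - 1) = 2 * i" "n * Suc n = 2 * j" by (metis evenE)
      moreover from this have "j = i + n" by (cases n) (auto simp: algebra_simps)
      ultimately show ?case using Suc by (simp add: mult.commute)
    qed simp
    finally show ?thesis by (simp add: algebra_simps)
  qed
  hence ex: "(\<Sum>m<b + E. E - (m - b)) = E * (b + 1) + E * (E - 1) div 2"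
    by (cases "E = 0") auto
  have "card T = nat Q ^ (\<Sum>m<b + E. E - (m - b))"
    using Q by (simp add: T_def card_PiE nat_power_eq power_sum)
  also have "\<dots> < card \<P>"
    unfolding ex cP by (rule power_strict_increasing[OF count]) (use Q in auto)
  finally have "card T < card \<P>" .
  moreover have "card (F ` \<P>) \<le> card T" by (rule card_mono[OF finT FT])
  ultimately have "\<not> inj_on F \<P>"
    using pigeonhole[of F \<P>] by linarith
  then obtain p p' where p: "p \<in> \<P>" "p' \<in> \<P>" "p \<noteq> p'" "F p = F p'"
    by (auto simp: inj_on_def)
  define D where "D = (\<lambda>i. g p i - g p' i)"
  have "\<exists>i\<in>I. p i \<noteq> p' i"
    using p(1-3) by (auto simp: \<P>_def PiE_def extensional_def fun_eq_iff) metis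
  hence 1: "\<exists>i\<in>I. D i \<noteq> 0" by (auto simp: D_def g_def)
  have 2: "\<bar>D i\<bar> < Q ^ h" for i
  proof (cases "i \<in> I")
    case True
    hence "p i \<in> {0..<Q ^ h}" "p' i \<in> {0..<Q ^ h}" using p by (auto simp: \<P>_def)
    thus ?thesis using True by (auto simp: D_def g_def)
  qed (use Q in \<open>simp add: D_def g_def\<close>)
  have 3: "Q ^ E dvd c m D" for m
  proof (cases "m < b + E")
    case True
    define k where "k = m - b"
    have "k \<le> E" using True by (auto simp: k_def)
    from p(4) have "F p m = F p' m" by simp
    hence "[c m (g p) div Q ^ k = c m (g p') div Q ^ k] (mod Q ^ (E - k))"
      using True by (simp add: F_def k_def cong_def)
    hence "Q ^ (E - k) dvd c m (g p) div Q ^ k - c m (g p') div Q ^ k"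
      by (simp add: cong_iff_dvd_diff)
    hence "Q ^ k * Q ^ (E - k) dvd Q ^ k * (c m (g p) div Q ^ k) - Q ^ k * (c m (g p') div Q ^ k)"
      by (simp add: mult_dvd_mono flip: right_diff_distrib)
    also have "Q ^ k * (c m (g p) div Q ^ k) - Q ^ k * (c m (g p') div Q ^ k) = c m D"
      using dv[where m=m] lin by (simp add: k_def D_def)
    also have "Q ^ k * Q ^ (E - k) = Q ^ E"
      using \<open>k \<le> E\<close> by (simp flip: power_add)
    finally show ?thesis .
  next
    case False
    hence "Q ^ E dvd Q ^ (m - b)" by (intro le_imp_power_dvd) auto
    thus ?thesis using dv dvd_trans by blast
  qed
  from 1 2 3 show ?thesis by blast
qed

lemma binomial_poly_exists:
  "\<exists>b :: real poly. degree b \<le> k \<and> (\<forall>z::nat. poly b (real z) = real (z choose k))"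
proof -
  define b :: "real poly" where "b = smult (1 / fact k) (\<Prod>t = 0..<k. [:- real t, 1:])"
  have "degree (\<Prod>t = 0..<k. [:- real t, 1:]) \<le> (\<Sum>t = 0..<k. 1)"
    by (rule order.trans[OF degree_prod_sum_le]) auto
  hence "degree b \<le> k"
    unfolding b_def using degree_smult_le[of "1 / fact k :: real" "\<Prod>t = 0..<k. [:- real t, 1:]"] by simp
  moreover have "poly b (real z) = real (z choose k)" for z
    by (simp add: b_def poly_prod binomial_gbinomial gbinomial_prod_rev)
  ultimately show ?thesis by blast
qed

text \<open>Write \<open>W ^ k / fact k\<close> as \<open>(W / K) ^ k\<close> times
  \<open>K ^ k / fact k\<close>; the last factor is one term of the series of \<open>exp K\<close>,
  hence at most \<open>3 ^ K\<close>. The bound is uniform in \<open>k\<close>.\<close>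

lemma binomial_bound:
  assumes "k \<le> K" "K > 0" "real K \<le> W" "real z \<le> W"
  shows "real (z choose k) \<le> (3 * W / K) ^ K"
proof -
  have "real (z choose k) * fact k \<le> real z ^ k"
    using binomial_fact_pow[of z k]
    by (metis of_nat_fact of_nat_le_iff of_nat_mult of_nat_power)
  also have "\<dots> \<le> W ^ k" using assms by (intro power_mono) auto
  finally have "real (z choose k) \<le> W ^ k / fact k" by (simp add: field_simps)
  also have "\<dots> = (W / K) ^ k * (real K ^ k / fact k)" using assms by (simp add: power_divide)
  also have "\<dots> \<le> (W / K) ^ K * 3 ^ K"
  proof (intro mult_mono)
    show "(W / K) ^ k \<le> (W / K) ^ K" using assms by (intro power_increasing) auto
    have "real K ^ k / fact k = (\<Sum>n\<in>{k}. real K ^ n / fact n)" by simp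
    also have "\<dots> \<le> exp (real K)"
    proof -
      have "(\<Sum>n\<in>{k}. real K ^ n / fact n) \<le> suminf (\<lambda>n. real K ^ n / fact n)"
        using summable_exp[of "real K"] by (intro sum_le_suminf) (auto simp: field_simps)
      thus ?thesis by (simp add: exp_def divide_inverse mult.commute)
    qed
    also have "\<dots> = exp 1 ^ K" using exp_of_nat_mult[of K "1::real"] by simp
    also have "\<dots> \<le> 3 ^ K" using exp_le by (intro power_mono) auto
    finally show "real K ^ k / fact k \<le> 3 ^ K" .
  qed (use assms in auto)
  also have "\<dots> = (3 * W / K) ^ K" by (simp add: power_mult_distrib power_divide)
  finally show ?thesis .
qed

text \<open>
  Schneider's method with \<open>L\<close> exponentials, polynomial coefficients of degree less than \<open>K\<close>, and the points
  \<open>i + j u\<close> for \<open>i < I0\<close>, \<open>j < J\<close>. The number \<open>N = K L\<close> of unknown coefficients is also the exponent of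
  \<open>Q\<close> in the divisibility. The numerical constants balance the pigeonhole bound \<open>Q ^ h\<close> for the
  coefficients, the size of the values at the points, and \<open>I0 J0 > L (K - 1)\<close> for the zero estimate.
\<close>
lemma linear_form_contradiction:
  fixes Q \<alpha> R c u T a n :: nat
  assumes Q: "Q \<ge> 2" and \<alpha>: "[\<alpha> = 1] (mod Q)" "0 < \<alpha>" "\<alpha> < Q ^ a"
    and Rc: "0 < c" "c < R" "R \<le> Q ^ 2" and close: "[R * \<alpha> ^ u = c] (mod Q ^ T)"
    and a: "a \<ge> 2" and n: "n \<ge> 1" and u: "u < Q ^ (n - 1)" "2625 * n ^ 2 \<le> u"
    and T: "2450 * a * n ^ 2 \<le> T"
  shows False
proof -
  \<comment> \<open>The choice gives \<open>K * L = I0 * J0 = N\<close> and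
    \<open>h = K + N / 2\<close>. The zero estimate uses up to \<open>L\<close> successive shifts of
    a point by \<open>u\<close>, which explains \<open>J = J0 + L\<close>.\<close>
  define L K N where "L = 5 * n" and "K = 490 * a * n" and "N = 2450 * a * n ^ 2"
  define I0 J0 J where "I0 = 70 * n" and "J0 = 35 * a * n" and "J = J0 + L"
  define h where "h = K + 1225 * a * n ^ 2"
  have KL: "K * L = N" by (simp add: K_def L_def N_def power2_eq_square)
  have pos: "L > 0" "K > 0" "N > 0" "I0 > 0" using n a by (auto simp: L_def K_def N_def I0_def)
  define Id where "Id = {..<K} \<times> {..<L}"
  have Id: "finite Id" "card Id = N" by (auto simp: Id_def KL)
  \<comment> \<open>The coefficient of \<open>z choose m\<close> in the value
    \<open>\<phi> z\<close> introduced below, by \<open>binomial_power_expand\<close> for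
    \<open>\<alpha> ^ l\<close>.\<close>
  define cc :: "nat \<Rightarrow> (nat \<times> nat \<Rightarrow> int) \<Rightarrow> int" where
    "cc m p = (\<Sum>(k, l)\<in>Id. p (k, l) * (int \<alpha> ^ (l * k) * int (m choose k) * (int \<alpha> ^ l - 1) ^ (m - k)))" for m p
  have XQ: "int Q dvd int \<alpha> ^ l - 1" for l
  proof -
    have "[int \<alpha> ^ l = 1 ^ l] (mod int Q)"
      using \<alpha>(1) by (intro cong_pow) (metis cong_int_iff of_nat_1)
    thus ?thesis by (simp add: cong_iff_dvd_diff)
  qed
  have "\<exists>D. (\<exists>i\<in>Id. D i \<noteq> 0) \<and> (\<forall>i. \<bar>D i\<bar> < int Q ^ h) \<and> (\<forall>m. int Q ^ N dvd cc m D)"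
  proof (rule pigeonhole_coeffs[where b = "K - 1"])
    show "cc m (\<lambda>i. p i - p' i) = cc m p - cc m p'" for m p p'
      by (simp add: cc_def sum_subtractf case_prod_beta left_diff_distrib)
    show "int Q ^ (m - (K - 1)) dvd cc m p" for m p
      unfolding cc_def
    proof (rule dvd_sum)
      fix kl assume kl: "kl \<in> Id"
      obtain k l where [simp]: "kl = (k, l)" by (cases kl)
      have "int Q ^ (m - (K - 1)) dvd int Q ^ (m - k)"
        using kl by (intro le_imp_power_dvd) (auto simp: Id_def)
      also have "\<dots> dvd (int \<alpha> ^ l - 1) ^ (m - k)" by (intro dvd_power_same XQ)
      finally show "int Q ^ (m - (K - 1)) dvd (case kl of (k, l) \<Rightarrow>
          p (k, l) * (int \<alpha> ^ (l * k) * int (m choose k) * (int \<alpha> ^ l - 1) ^ (m - k)))" by simp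
    qed
    have "N * (N - 1) div 2 < N * (1225 * a * n ^ 2)"
    proof -
      have "N * (N - 1) < N * N" using pos by auto
      hence "N * (N - 1) div 2 < (N * N + 1) div 2" by linarith
      also have "N * N = 2 * (N * (1225 * a * n ^ 2))" by (simp add: N_def)
      finally show ?thesis by simp
    qed
    thus "N * (K - 1 + 1) + N * (N - 1) div 2 < h * card Id"
      using pos by (simp add: Id h_def algebra_simps)
  qed (use Id Q in auto)
  then obtain D where D: "\<exists>i\<in>Id. D i \<noteq> 0" "\<And>i. \<bar>D i\<bar> < int Q ^ h" "\<And>m. int Q ^ N dvd cc m D"
    by blast
  define \<phi> where "\<phi> z = (\<Sum>(k, l)\<in>Id. D (k, l) * (int (z choose k) * int \<alpha> ^ (l * z)))" for z
  have \<phi>: "int Q ^ N dvd \<phi> z" for z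
  proof -
    have "\<phi> z = (\<Sum>(k, l)\<in>Id. D (k, l) * (\<Sum>m\<le>z. (int \<alpha> ^ (l * k) * int (m choose k) * (int \<alpha> ^ l - 1) ^ (m - k)) * int (z choose m)))"
      unfolding \<phi>_def
    proof (intro sum.cong refl, clarify)
      fix k l
      show "D (k, l) * (int (z choose k) * int \<alpha> ^ (l * z)) =
        D (k, l) * (\<Sum>m\<le>z. (int \<alpha> ^ (l * k) * int (m choose k) * (int \<alpha> ^ l - 1) ^ (m - k)) * int (z choose m))"
        using binomial_power_expand[of z k "int \<alpha> ^ l"] by (simp add: power_mult)
    qed
    also have "\<dots> = (\<Sum>m\<le>z. cc m D * int (z choose m))"
      unfolding cc_def case_prod_beta sum_distrib_left sum_distrib_right
      by (subst sum.swap) (simp add: mult_ac)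
    also have "int Q ^ N dvd \<dots>" by (intro dvd_sum dvd_mult2 D(3))
    finally show ?thesis .
  qed
  \<comment> \<open>At the point \<open>i + j * u\<close> the power \<open>\<alpha> ^ u\<close> is
    replaced by \<open>c / R\<close> as \<open>close\<close> suggests, with denominators cleared by
    \<open>R ^ ((L - 1) * j)\<close>. Divisibility by \<open>Q ^ N\<close> persists, while the huge
    power of \<open>\<alpha>\<close> disappears.\<close>
  define \<Phi> where "\<Phi> i j = (\<Sum>(k, l)\<in>Id. D (k, l) * (int ((i + j * u) choose k) *
      (int \<alpha> ^ (l * i) * int c ^ (l * j) * int R ^ ((L - 1 - l) * j))))" for i j
  have \<Phi>_dvd: "int Q ^ N dvd \<Phi> i j" for i j
  proof -
    have "[int (R * \<alpha> ^ u) = int c] (mod int (Q ^ T))"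
      using close by (simp only: cong_int_iff)
    moreover have "int Q ^ N dvd int (Q ^ T)"
      using T by (simp add: N_def le_imp_power_dvd)
    ultimately have cl: "[int R * int \<alpha> ^ u = int c] (mod int Q ^ N)"
      using cong_dvd_modulus by fastforce
    have "[(\<Sum>(k, l)\<in>Id. D (k, l) * (int ((i + j * u) choose k) *
        (int \<alpha> ^ (l * i) * (int R * int \<alpha> ^ u) ^ (l * j) * int R ^ ((L - 1 - l) * j)))) = \<Phi> i j] (mod int Q ^ N)"
      unfolding \<Phi>_def case_prod_beta by (intro cong_sum cong_mult cong_refl cong_pow cl)
    also have "(\<Sum>(k, l)\<in>Id. D (k, l) * (int ((i + j * u) choose k) *
        (int \<alpha> ^ (l * i) * (int R * int \<alpha> ^ u) ^ (l * j) * int R ^ ((L - 1 - l) * j))))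
        = int R ^ ((L - 1) * j) * \<phi> (i + j * u)"
      unfolding \<phi>_def sum_distrib_left
    proof (intro sum.cong refl, clarify)
      fix k l assume "(k, l) \<in> Id"
      hence "(L - 1) * j = l * j + (L - 1 - l) * j"
        by (auto simp: Id_def simp flip: add_mult_distrib)
      hence RR: "int R ^ ((L - 1) * j) = int R ^ (l * j) * int R ^ ((L - 1 - l) * j)"
        by (simp only: power_add)
      show "D (k, l) * (int ((i + j * u) choose k) *
        (int \<alpha> ^ (l * i) * (int R * int \<alpha> ^ u) ^ (l * j) * int R ^ ((L - 1 - l) * j)))
        = int R ^ ((L - 1) * j) * (D (k, l) * (int ((i + j * u) choose k) * int \<alpha> ^ (l * (i + j * u))))"
        unfolding RR by (simp add: power_mult_distrib power_add power_mult[symmetric] distrib_left mult_ac)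
    qed
    finally have "[int R ^ ((L - 1) * j) * \<phi> (i + j * u) = \<Phi> i j] (mod int Q ^ N)" .
    thus ?thesis using \<phi> by (meson cong_dvd_iff dvd_mult)
  qed
  have u0: "real I0 \<le> real u" "u > 0"
  proof -
    have "70 * n \<le> 2625 * n ^ 2" using n by (simp add: power2_eq_square)
    thus "real I0 \<le> real u" "u > 0" using u n by (auto simp: I0_def)
  qed
  have \<Phi>0: "\<Phi> i j = 0" if ij: "i < I0" "j < J" for i j
  proof (rule ccontr)
    assume nz: "\<Phi> i j \<noteq> 0"
    \<comment> \<open>Since \<open>12 * J \<le> K\<close>, the bound leaves a spare factor
      \<open>4 ^ K\<close>, which absorbs the number \<open>N\<close> of terms in
      \<open>small\<close>.\<close>
    have bin: "real ((i + j * u) choose k) \<le> (real u / 4) ^ K" if "k < K" for k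
    proof -
      have "i + j * u \<le> u + j * u" using ij u0 by auto
      also have "\<dots> = (j + 1) * u" by simp
      also have "\<dots> \<le> J * u" using ij by (intro mult_right_mono) auto
      finally have z: "real (i + j * u) \<le> real (J * u)" by linarith
      have "K \<le> J * u"
      proof -
        have "K = J0 * 14" by (simp add: K_def J0_def)
        also have "\<dots> \<le> J * u"
          using u0 n by (intro mult_mono) (auto simp: J_def I0_def)
        finally show ?thesis .
      qed
      hence "real K \<le> real (J * u)" by (simp only: of_nat_le_iff)
      hence "real ((i + j * u) choose k) \<le> (3 * real (J * u) / K) ^ K"
        using z that by (intro binomial_bound) simp_all
      also have "\<dots> \<le> (real u / 4) ^ K"
      proof (intro power_mono)
        have "12 * J \<le> K" using a by (simp add: J_def J0_def L_def K_def)
        hence "12 * real J * real u \<le> real K * real u" by (intro mult_right_mono) auto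
        thus "3 * real (J * u) / K \<le> real u / 4" using pos by (simp add: field_simps)
      qed auto
      finally show ?thesis .
    qed
    have each: "real_of_int \<bar>D (k, l) * (int ((i + j * u) choose k) *
      (int \<alpha> ^ (l * i) * int c ^ (l * j) * int R ^ ((L - 1 - l) * j)))\<bar>
      \<le> real Q ^ h * ((real u / 4) ^ K * (real \<alpha> ^ (L * I0) * real R ^ (L * J)))" if kl: "(k, l) \<in> Id" for k l
    proof -
      have "real_of_int \<bar>D (k, l)\<bar> \<le> real Q ^ h"
        using D(2)[of "(k, l)"] by (metis less_imp_le of_int_le_iff of_int_of_nat_eq of_int_power)
      moreover have "real \<alpha> ^ (l * i) \<le> real \<alpha> ^ (L * I0)"
        using kl ij \<alpha> by (intro power_increasing mult_mono) (auto simp: Id_def)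
      moreover have "real c ^ (l * j) * real R ^ ((L - 1 - l) * j) \<le> real R ^ (L * J)"
      proof -
        have "real c ^ (l * j) * real R ^ ((L - 1 - l) * j) \<le> real R ^ (l * j) * real R ^ ((L - 1 - l) * j)"
          using Rc by (intro mult_right_mono power_mono) auto
        also have "\<dots> = real R ^ ((L - 1) * j)"
          using kl by (auto simp: Id_def simp flip: power_add add_mult_distrib)
        also have "\<dots> \<le> real R ^ (L * J)"
          using ij Rc by (intro power_increasing mult_mono) auto
        finally show ?thesis .
      qed
      moreover have "real ((i + j * u) choose k) \<le> (real u / 4) ^ K"
        using kl by (intro bin) (auto simp: Id_def)
      ultimately have "real_of_int \<bar>D (k, l)\<bar> * (real ((i + j * u) choose k) *
          (real \<alpha> ^ (l * i) * (real c ^ (l * j) * real R ^ ((L - 1 - l) * j))))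
        \<le> real Q ^ h * ((real u / 4) ^ K * (real \<alpha> ^ (L * I0) * real R ^ (L * J)))"
        by (intro mult_mono) auto
      thus ?thesis by (simp add: abs_mult mult.assoc)
    qed
    have small: "real N * (real u / 4) ^ K \<le> real u ^ K"
    proof -
      have "N \<le> K * K" unfolding KL[symmetric] using n a by (intro mult_left_mono) (auto simp: K_def L_def)
      also have "\<dots> \<le> 2 ^ K * 2 ^ K" by (intro mult_mono) (simp_all add: less_imp_le)
      also have "\<dots> = 4 ^ K" by (simp flip: power_mult_distrib)
      finally have "real N \<le> 4 ^ K" by (metis of_nat_le_iff of_nat_numeral of_nat_power)
      hence "real N * (real u / 4) ^ K \<le> 4 ^ K * (real u / 4) ^ K" by (intro mult_right_mono) auto
      thus ?thesis using pos(2) by (simp flip: power_mult_distrib)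
    qed
    have "real_of_int \<bar>\<Phi> i j\<bar> \<le> (\<Sum>(k, l)\<in>Id. real_of_int \<bar>D (k, l) * (int ((i + j * u) choose k) *
      (int \<alpha> ^ (l * i) * int c ^ (l * j) * int R ^ ((L - 1 - l) * j)))\<bar>)"
      unfolding \<Phi>_def case_prod_beta of_int_abs of_int_sum by (rule sum_abs)
    also have "\<dots> \<le> (\<Sum>(k, l)\<in>Id. real Q ^ h * ((real u / 4) ^ K * (real \<alpha> ^ (L * I0) * real R ^ (L * J))))"
      using each by (intro sum_mono) auto
    also have "\<dots> = real Q ^ h * (real N * (real u / 4) ^ K) * (real \<alpha> ^ (L * I0) * real R ^ (L * J))"
      by (simp add: Id case_prod_beta)
    also have "\<dots> \<le> real Q ^ h * real u ^ K * (real \<alpha> ^ (L * I0) * real R ^ (L * J))"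
      by (intro mult_right_mono mult_left_mono small) auto
    also have "real Q ^ h * real u ^ K * (real \<alpha> ^ (L * I0) * real R ^ (L * J))
        < real Q ^ h * (real Q ^ (n - 1)) ^ K * ((real Q ^ a) ^ (L * I0) * (real Q ^ 2) ^ (L * J))"
    proof -
      have "real u < real Q ^ (n - 1)" using u(1) by (metis of_nat_less_iff of_nat_power)
      moreover have "real \<alpha> \<le> real Q ^ a" using \<alpha>(3) by (metis less_imp_le of_nat_le_iff of_nat_power)
      moreover have "real R \<le> real Q ^ 2" using Rc(3) by (metis of_nat_le_iff of_nat_power)
      ultimately have "real u ^ K < (real Q ^ (n - 1)) ^ K"
        "real \<alpha> ^ (L * I0) * real R ^ (L * J) \<le> (real Q ^ a) ^ (L * I0) * (real Q ^ 2) ^ (L * J)"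
        using pos(2) by (simp_all add: power_strict_mono mult_mono power_mono)
      moreover from this(1) have "real Q ^ h * real u ^ K < real Q ^ h * (real Q ^ (n - 1)) ^ K"
        using Q by (intro mult_strict_left_mono) auto
      moreover have "real \<alpha> ^ (L * I0) * real R ^ (L * J) > 0" using \<alpha>(2) Rc by auto
      moreover have "0 \<le> real Q ^ h * real u ^ K" by simp
      ultimately show ?thesis using mult_less_le_imp_less by blast
    qed
    also have "\<dots> = real Q ^ (h + (n - 1) * K + (a * (L * I0) + 2 * (L * J)))"
      by (simp add: power_add power_mult)
    also have "\<dots> \<le> real Q ^ N"
    proof (intro power_increasing)
      \<comment> \<open>The exponents of \<open>Q\<close> coming from the coefficients, the
        binomials, \<open>\<alpha>\<close> and \<open>R\<close> sum to at most
        \<open>2440 * a * n ^ 2\<close>, because \<open>a \<ge> 2\<close>.\<close>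
      have "h + (n - 1) * K = n * K + 1225 * a * n ^ 2" using n by (cases n) (auto simp: h_def)
      also have "\<dots> + (a * (L * I0) + 2 * (L * J)) = 2415 * (a * n ^ 2) + 50 * n ^ 2"
        by (simp add: K_def L_def I0_def J_def J0_def algebra_simps power2_eq_square)
      also have "\<dots> \<le> N"
      proof -
        have "2 * n ^ 2 \<le> a * n ^ 2" using a by (intro mult_right_mono) auto
        thus ?thesis unfolding N_def mult.assoc by linarith
      qed
      finally show "h + (n - 1) * K + (a * (L * I0) + 2 * (L * J)) \<le> N" .
    qed (use Q in auto)
    finally have "real_of_int \<bar>\<Phi> i j\<bar> < real_of_int (int Q ^ N)" by simp
    hence "\<bar>\<Phi> i j\<bar> < int Q ^ N" by (simp only: of_int_less_iff)
    moreover have "int Q ^ N \<le> \<bar>\<Phi> i j\<bar>"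
      using dvd_imp_le_int[OF nz \<Phi>_dvd] by simp
    ultimately show False by simp
  qed
  obtain bp :: "nat \<Rightarrow> real poly" where bp: "\<And>k. degree (bp k) \<le> k"
    "\<And>k z. poly (bp k) (real z) = real (z choose k)"
    using binomial_poly_exists by metis
  define A where "A l = (\<Sum>k<K. smult (of_int (D (k, l))) (bp k))" for l
  have polyA: "poly (A l) (real z) = (\<Sum>k<K. of_int (D (k, l)) * real (z choose k))" for l z
    by (simp add: A_def poly_sum bp)
  have degA: "degree (A l) \<le> K - 1" for l
    unfolding A_def
  proof (rule degree_sum_le)
    fix k assume "k \<in> {..<K}"
    hence "degree (bp k) \<le> K - 1" using bp(1)[of k] by auto
    thus "degree (smult (of_int (D (k, l))) (bp k)) \<le> K - 1"
      using degree_smult_le order.trans by blast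
  qed auto
  define S where "S = {l. l < L \<and> A l \<noteq> 0}"
  have "S \<noteq> {}"
  proof -
    obtain k l where kl: "k < K" "l < L" "D (k, l) \<noteq> 0" using D(1) by (auto simp: Id_def)
    \<comment> \<open>Binomial polynomials are triangular at the integers: at the least index
      \<open>k0\<close> with a nonzero coefficient, \<open>A l\<close> takes the value
      \<open>D (k0, l)\<close>.\<close>
    define k0 where "k0 = (LEAST k. D (k, l) \<noteq> 0)"
    have k0: "D (k0, l) \<noteq> 0" unfolding k0_def by (rule LeastI[of _ k]) (rule kl)
    have lt: "D (k', l) = 0" if "k' < k0" for k' using not_less_Least that unfolding k0_def by blast
    have "k0 \<le> k" unfolding k0_def by (rule Least_le) (rule kl)
    have "poly (A l) (real k0) = (\<Sum>k\<in>{k0}. of_int (D (k, l)) * real (k0 choose k))"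
      unfolding polyA
    proof (rule sum.mono_neutral_right)
      show "\<forall>i\<in>{..<K} - {k0}. of_int (D (i, l)) * real (k0 choose i) = 0"
        using lt by (auto simp: neq_iff binomial_eq_0)
    qed (use \<open>k0 \<le> k\<close> kl in auto)
    hence "A l \<noteq> 0" using k0 by auto
    thus ?thesis using kl by (auto simp: S_def)
  qed
  have finS: "finite S" and cardS: "card S \<le> L"
    using card_mono[of "{..<L}" S] by (auto simp: S_def)
  define \<rho> where "\<rho> = real c / real R"
  have \<rho>: "0 < \<rho>" "\<rho> < 1" using Rc by (auto simp: \<rho>_def)
  define Z where "Z = (\<lambda>(i, j). real (i + j * u)) ` ({..<I0} \<times> {..<J0})"
  \<comment> \<open>As \<open>I0 \<le> u\<close>, the numbers \<open>i\<close> and \<open>j\<close>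
    are recovered as remainder and quotient of the point modulo \<open>u\<close>.\<close>
  have "inj_on (\<lambda>(i, j). real (i + j * u)) ({..<I0} \<times> {..<J0})"
  proof (rule inj_onI, clarify)
    fix i j i' j' assume *: "i < I0" "i' < I0" "real (i + j * u) = real (i' + j' * u)"
    have lt: "i < u" "i' < u" using * u0 by auto
    have eq: "i + j * u = i' + j' * u" using *(3) by linarith
    have "(i + j * u) mod u = (i' + j' * u) mod u" "(i + j * u) div u = (i' + j' * u) div u"
      using eq by simp_all
    thus "i = i' \<and> j = j'" using lt by simp
  qed
  hence cardZ: "card Z = I0 * J0" by (simp add: Z_def card_image)
  have "finite Z \<and> card Z \<le> card S * (K - 1)"
  proof (rule zero_estimate[OF \<rho> finS])
    fix x assume "x \<in> Z"
    then obtain i j where ij: "i < I0" "j < J0" and x: "x = real (i + j * u)" by (auto simp: Z_def)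
    \<comment> \<open>With this \<open>y\<close> the factor \<open>\<rho> ^ (l * s) * y ^ l\<close>
      equals \<open>\<alpha> ^ (l * i) * \<rho> ^ (l * (j + s))\<close>, so the sum is
      \<open>\<Phi> i (j + s)\<close> divided by a power of \<open>R\<close>.\<close>
    define y where "y = real \<alpha> ^ i * \<rho> ^ j"
    have "y \<noteq> 0" using \<rho> \<alpha> by (simp add: y_def)
    moreover have "(\<Sum>l\<in>S. poly (A l) (x + real s * real u) * \<rho> ^ (l * s) * y ^ l) = 0" if s: "s < card S" for s
    proof -
      define t where "t = j + s"
      have t: "t < J" using ij s cardS by (simp add: t_def J_def)
      have xt: "x + real s * real u = real (i + t * u)" by (simp add: x t_def algebra_simps)
      have "(\<Sum>l\<in>S. poly (A l) (x + real s * real u) * \<rho> ^ (l * s) * y ^ l)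
          = (\<Sum>l<L. poly (A l) (x + real s * real u) * \<rho> ^ (l * s) * y ^ l)"
        by (rule sum.mono_neutral_left) (auto simp: S_def)
      also have "\<dots> = (\<Sum>l<L. \<Sum>k<K. of_int (D (k, l)) * real ((i + t * u) choose k) * (real \<alpha> ^ (l * i) * \<rho> ^ (l * t)))"
        unfolding xt polyA sum_distrib_right
        by (intro sum.cong refl)
          (simp add: y_def t_def power_mult_distrib power_add distrib_left mult_ac flip: power_mult)
      also have "\<dots> = (\<Sum>(k, l)\<in>Id. of_int (D (k, l)) * real ((i + t * u) choose k) * (real \<alpha> ^ (l * i) * \<rho> ^ (l * t)))"
        unfolding Id_def by (subst sum.swap) (simp add: sum.cartesian_product)
      also have "\<dots> = (\<Sum>(k, l)\<in>Id. of_int (D (k, l) * (int ((i + t * u) choose k) *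
          (int \<alpha> ^ (l * i) * int c ^ (l * t) * int R ^ ((L - 1 - l) * t)))) / real R ^ ((L - 1) * t))"
      proof (intro sum.cong refl, clarify)
        fix k l assume "(k, l) \<in> Id"
        hence "(L - 1) * t = l * t + (L - 1 - l) * t"
          by (auto simp: Id_def simp flip: add_mult_distrib)
        hence RR: "real R ^ ((L - 1) * t) = real R ^ (l * t) * real R ^ ((L - 1 - l) * t)"
          by (simp only: power_add)
        show "of_int (D (k, l)) * real ((i + t * u) choose k) * (real \<alpha> ^ (l * i) * \<rho> ^ (l * t)) =
          of_int (D (k, l) * (int ((i + t * u) choose k) *
          (int \<alpha> ^ (l * i) * int c ^ (l * t) * int R ^ ((L - 1 - l) * t)))) / real R ^ ((L - 1) * t)"
          unfolding RR using Rc by (simp add: \<rho>_def power_divide field_simps)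
      qed
      also have "\<dots> = of_int (\<Phi> i t) / real R ^ ((L - 1) * t)"
        by (simp add: \<Phi>_def case_prod_beta sum_divide_distrib)
      also have "\<dots> = 0" using \<Phi>0[OF ij(1) t] by simp
      finally show ?thesis .
    qed
    ultimately show "\<exists>y. y \<noteq> 0 \<and> (\<forall>s<card S.
        (\<Sum>l\<in>S. poly (A l) (x + real s * real u) * \<rho> ^ (l * s) * y ^ l) = 0)" by blast
  qed (use degA \<open>S \<noteq> {}\<close> in \<open>auto simp: S_def\<close>)
  hence "I0 * J0 \<le> card S * (K - 1)" using cardZ by simp
  also have "\<dots> \<le> L * (K - 1)" using cardS by (intro mult_right_mono) auto
  also have "\<dots> < L * K" using pos by simp
  also have "\<dots> = I0 * J0" by (simp add: L_def K_def I0_def J0_def algebra_simps)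
  finally show False by simp
qed

section \<open>Repunits\<close>

definition repunit :: "nat \<Rightarrow> nat \<Rightarrow> nat" where
  "repunit B n = (\<Sum>i<n. B ^ i)"

lemma repunit_0 [simp]: "repunit B 0 = 0" and repunit_1 [simp]: "repunit B (Suc 0) = 1"
  by (simp_all add: repunit_def)

lemma repunit_add: "repunit B (m + n) = repunit B m + B ^ m * repunit B n"
  by (induction n) (auto simp: repunit_def power_add algebra_simps)

lemma repunit_Suc: "repunit B (Suc n) = 1 + B * repunit B n"
  using repunit_add[of B 1 n] by simp

lemma repunit_Suc': "repunit B (Suc n) = repunit B n + B ^ n"
  using repunit_add[of B n 1] by simp

lemma repunit_power_eq_int: "(int B - 1) * int (repunit B n) = int B ^ n - 1"
  by (induction n) (auto simp: repunit_Suc' algebra_simps)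

lemma repunit_mult: "repunit B (m * n) = repunit B m * repunit (B ^ m) n"
  by (induction n) (auto simp: repunit_Suc repunit_add power_mult algebra_simps)

lemma repunit_strict_mono: "B > 0 \<Longrightarrow> m < n \<Longrightarrow> repunit B m < repunit B n"
  by (rule lift_Suc_mono_less[of "repunit B"]) (auto simp: repunit_Suc')

lemma repunit_inj: "B > 0 \<Longrightarrow> repunit B m = repunit B n \<Longrightarrow> m = n"
  using repunit_strict_mono[of B m n] repunit_strict_mono[of B n m] by (cases m n rule: linorder_cases) auto

lemma coprime_repunit: "n > 0 \<Longrightarrow> coprime B (repunit B n)"
proof (cases n)
  case (Suc m)
  have "c dvd 1" if "c dvd B" "c dvd 1 + B * repunit B m" for c
    using that dvd_add_left_iff[of c "B * repunit B m" 1] by simp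
  thus ?thesis unfolding Suc repunit_Suc by (intro coprimeI)
qed simp

text \<open>Euclid's algorithm on the exponents: for \<open>m \<le> n\<close>,
  \<open>repunit_add\<close> splits \<open>repunit B n\<close>, and \<open>B ^ m\<close> is coprime
  to \<open>repunit B m\<close>.\<close>

lemma gcd_repunit: "gcd (repunit B m) (repunit B n) = repunit B (gcd m n)"
proof (induction "m + n" arbitrary: m n rule: less_induct)
  case less
  have *: "gcd (repunit B m) (repunit B n) = repunit B (gcd m n)"
    if le: "m \<le> n" and m: "m > 0" and IH: "\<And>m' n'. m' + n' < m + n \<Longrightarrow> gcd (repunit B m') (repunit B n') = repunit B (gcd m' n')"
    for m n
  proof -
    define k where "k = n - m"
    have n: "n = m + k" using le by (simp add: k_def)
    have "gcd (repunit B m) (repunit B n) = gcd (repunit B m) (B ^ m * repunit B k)"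
      by (simp add: n repunit_add)
    also have "\<dots> = gcd (repunit B m) (repunit B k)"
      using coprime_repunit[OF m, of B]
      by (intro gcd_mult_right_left_cancel) (simp add: coprime_commute)
    also have "\<dots> = repunit B (gcd m k)" using m by (intro IH) (simp add: n)
    also have "gcd m k = gcd m n" by (simp add: n)
    finally show ?thesis .
  qed
  show ?case
  proof (cases "m = 0 \<or> n = 0")
    case False
    show ?thesis
    proof (cases "m \<le> n")
      case True
      show ?thesis by (rule *[OF True]) (use False less in auto)
    next
      case F: False
      have "gcd (repunit B n) (repunit B m) = repunit B (gcd n m)"
      proof (rule *)
        fix m' n' assume "m' + n' < n + m"
        thus "gcd (repunit B m') (repunit B n') = repunit B (gcd m' n')" by (intro less) simp
      qed (use False F in auto)
      thus ?thesis by (simp add: gcd.commute)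
    qed
  qed auto
qed

text \<open>Without its last digit an equality of repunits reads
  \<open>P * repunit P (x - 1) = Q * repunit Q (y - 1)\<close>, and the gcd of two such equalities
  has the same shape.\<close>

lemma repunit_eq_closure:
  assumes "repunit P x = repunit Q y" "repunit P x' = repunit Q y'" "x > 0" "x' > 0" "y > 0" "y' > 0"
  shows "repunit P (Suc (gcd (x - 1) (x' - 1))) = repunit Q (Suc (gcd (y - 1) (y' - 1)))"
proof -
  have *: "P * repunit P (x - 1) = Q * repunit Q (y - 1)" if "repunit P x = repunit Q y" "x > 0" "y > 0" for x y
    using that by (cases x; cases y) (auto simp: repunit_Suc)
  have "gcd (P * repunit P (x - 1)) (P * repunit P (x' - 1)) = gcd (Q * repunit Q (y - 1)) (Q * repunit Q (y' - 1))"
    using *[OF assms(1,3,5)] *[OF assms(2,4,6)] by simp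
  thus ?thesis by (simp add: repunit_Suc gcd_repunit flip: gcd_mult_distrib_nat)
qed

section \<open>Lifting the exponent for repunits\<close>

text \<open>For odd \<open>q\<close> and \<open>\<alpha> = 1 + q s\<close>, expanding the powers to
  first order gives \<open>repunit \<alpha> q \<equiv> q\<close> modulo \<open>q ^ 2\<close>, since
  the linear terms sum to \<open>q s\<close> times the multiple \<open>q (q - 1) / 2\<close> of
  \<open>q\<close>. For \<open>q = 2\<close> the repunit is \<open>1 + \<alpha>\<close>, which needs
  the condition modulo 4.\<close>

lemma not_sq_dvd_repunit_prime:
  assumes q: "prime q" and \<alpha>: "[\<alpha> = 1] (mod q)" and two: "q = 2 \<Longrightarrow> [\<alpha> = 1] (mod 4)"
  shows "\<exists>k. repunit \<alpha> q = q * k \<and> \<not> q dvd k"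
proof (cases "q = 2")
  case True
  have "\<alpha> mod 4 = 1" using two[OF True] by (simp add: cong_def)
  hence "Suc \<alpha> mod 4 = 2" by presburger
  have "repunit \<alpha> q = Suc \<alpha>" using True by (simp add: repunit_def eval_nat_numeral)
  moreover have "Suc \<alpha> = 2 * (Suc \<alpha> div 2)" "\<not> 2 dvd Suc \<alpha> div 2" using \<open>Suc \<alpha> mod 4 = 2\<close> by presburger+
  ultimately show ?thesis using True by metis
next
  case False
  hence odd: "odd q" using prime_odd_nat[OF q] prime_ge_2_nat[OF q] by linarith
  have "q dvd q * (q - 1) div 2" 
  proof -
    obtain b where b: "q = 2 * b + 1" using odd by (rule oddE)
    have "q * (q - 1) div 2 = q * b" by (simp add: b)
    thus ?thesis by (simp only: dvd_triv_left)
  qed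
  then obtain s where s: "int \<alpha> = 1 + int q * s"
  proof -
    have "[1 = int \<alpha>] (mod int q)" using \<alpha> by (metis cong_int_iff cong_sym of_nat_1)
    thus ?thesis using that by (auto simp: cong_iff_lin)
  qed
  have pw: "[int \<alpha> ^ i = 1 + int i * (int q * s)] (mod (int q) ^ 2)" for i
  proof (induction i)
    case (Suc i)
    have "[int \<alpha> * int \<alpha> ^ i = (1 + int q * s) * (1 + int i * (int q * s))] (mod (int q) ^ 2)"
      unfolding s[symmetric] by (intro cong_mult Suc cong_refl)
    also have "(1 + int q * s) * (1 + int i * (int q * s)) = 1 + int (Suc i) * (int q * s) + (int q)^2 * (int i * s^2)"
      by (simp add: algebra_simps power2_eq_square)
    also have "[\<dots> = 1 + int (Suc i) * (int q * s)] (mod (int q) ^ 2)"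
      by (simp add: cong_def)
    finally show ?case by simp
  qed simp
  have "[int (repunit \<alpha> q) = (\<Sum>i<q. 1 + int i * (int q * s))] (mod (int q) ^ 2)"
    unfolding repunit_def of_nat_sum of_nat_power by (intro cong_sum pw)
  also have "(\<Sum>i<q. 1 + int i * (int q * s)) = int q + (\<Sum>i<q. int i) * (int q * s)"
    by (simp add: sum.distrib sum_distrib_right)
  also have "(\<Sum>i<q. int i) = int (q * (q - 1) div 2)"
  proof -
    have "(\<Sum>i<n. i) = n * (n - 1) div 2" for n :: nat
      using Sum_Ico_nat[of 0 n] by (simp add: atLeast0LessThan)
    hence "int (\<Sum>i<q. i) = int (q * (q - 1) div 2)" by (rule arg_cong)
    thus ?thesis by simp
  qed
  also have "[int q + int (q * (q - 1) div 2) * (int q * s) = int q] (mod (int q) ^ 2)"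
  proof -
    obtain t where t: "q * (q - 1) div 2 = q * t" using \<open>q dvd q * (q - 1) div 2\<close> by blast
    have "int (q * t) * (int q * s) = (int q) ^ 2 * (int t * s)" by (simp add: power2_eq_square)
    thus ?thesis unfolding t cong_iff_dvd_diff by (simp only: add_diff_cancel_left' dvd_triv_left)
  qed
  finally have "[repunit \<alpha> q = q] (mod q ^ 2)" by (metis cong_int_iff of_nat_power)
  hence c: "repunit \<alpha> q mod (q * q) = q mod (q * q)" by (simp add: cong_def power2_eq_square)
  have q2: "q < q * q" using prime_gt_1_nat[OF q] by simp
  hence "repunit \<alpha> q mod (q * q) = q" using c by simp
  hence r: "repunit \<alpha> q = q * (q * (repunit \<alpha> q div (q * q)) + 1)"
    using mult_div_mod_eq[of "q * q" "repunit \<alpha> q"] by (simp add: algebra_simps)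
  moreover have "\<not> q dvd q * (repunit \<alpha> q div (q * q)) + 1"
    using prime_gt_1_nat[OF q] dvd_add_right_iff[of q "q * (repunit \<alpha> q div (q * q))" 1] by auto
  ultimately show ?thesis by blast
qed

text \<open>As \<open>repunit \<alpha> w \<equiv> w\<close> modulo \<open>q\<close>, the prime
  divides \<open>w\<close>. Split off the factor \<open>repunit \<alpha> q\<close>, which contains
  \<open>q\<close> exactly once, and continue with \<open>\<alpha> ^ q\<close> and
  \<open>w / q\<close>.\<close>

lemma prime_power_dvd_repunit:
  assumes q: "prime q" and "[\<alpha> = 1] (mod q)" and "q = 2 \<Longrightarrow> [\<alpha> = 1] (mod 4)" and "q ^ e dvd repunit \<alpha> w"
  shows "q ^ e dvd w"
  using assms(2-)
proof (induction e arbitrary: \<alpha> w)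
  case (Suc e)
  have "[repunit \<alpha> w = (\<Sum>i<w. 1 ^ i)] (mod q)"
    unfolding repunit_def by (intro cong_sum cong_pow Suc)
  hence "[repunit \<alpha> w = w] (mod q)" by simp
  moreover have "q dvd repunit \<alpha> w" using Suc(4) by (meson dvd_trans dvd_power zero_less_Suc)
  ultimately have "q dvd w" by (simp add: cong_dvd_iff)
  then obtain w' where w: "w = q * w'" by blast
  obtain k where k: "repunit \<alpha> q = q * k" "\<not> q dvd k"
    using not_sq_dvd_repunit_prime[OF q Suc(2,3)] by blast
  have "q * q ^ e dvd q * (k * repunit (\<alpha> ^ q) w')" using Suc(4) by (simp add: w repunit_mult k mult.assoc)
  hence "q ^ e dvd k * repunit (\<alpha> ^ q) w'" using prime_gt_0_nat[OF q] by simp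
  moreover have "coprime (q ^ e) k" using q k(2) by (simp add: prime_imp_coprime)
  ultimately have "q ^ e dvd repunit (\<alpha> ^ q) w'" by (simp add: coprime_dvd_mult_right_iff)
  moreover have "[\<alpha> ^ q = 1] (mod q)" using cong_pow[OF Suc(2), of q] by simp
  moreover have "[\<alpha> ^ q = 1] (mod 4)" if "q = 2" using cong_pow[OF Suc(3)[OF that], of q] by simp
  ultimately have "q ^ e dvd w'" using Suc.IH by blast
  thus ?case by (simp add: w)
qed simp

section \<open>Excluding a second solution when the first one is large\<close>

text \<open>In the application \<open>\<alpha> = P ^ (x - 1)\<close> and
  \<open>Y = Q ^ (y - 1)\<close> for the minimal solution \<open>(x, y)\<close>. As
  \<open>\<alpha>\<close> and \<open>Y\<close> are close, \<open>v\<close> is not much smaller than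
  \<open>u\<close>, so that a linear form with exponent \<open>u\<close> vanishes modulo the very
  high power \<open>Q ^ (a * v)\<close>.\<close>

lemma no_large_repunit_solution:
  fixes P Q \<alpha> Y u v a :: nat
  assumes P: "2 \<le> P" "P < Q" and a: "a \<ge> 2" and Y: "Y = Q ^ a" and \<alpha>: "[\<alpha> = 1] (mod Q)" "\<alpha> > 0"
    and ratio: "P * (Q - 1) * (\<alpha> - 1) = Q * (P - 1) * (Y - 1)"
    and eq: "repunit \<alpha> u = repunit Y v" and u: "Y < u" and big: "2625 * (a + 2) ^ 2 \<le> Y"
  shows False
proof -
  have Y15: "2 ^ 15 \<le> Y"
  proof -
    have "4 ^ 2 \<le> (a + 2) ^ 2" using a by (intro power_mono) auto
    thus ?thesis using big by simp
  qed
  have r: "int P * (int Q - 1) * (int \<alpha> - 1) = int Q * (int P - 1) * (int Y - 1)"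
    using arg_cong[OF ratio, of int] P \<alpha> Y15 by (simp add: of_nat_diff)
  \<comment> \<open>By \<open>ratio\<close>, the quotient of \<open>\<alpha> - 1\<close> by
    \<open>Y - 1\<close> is \<open>(1 - 1/P) / (1 - 1/Q)\<close>, which lies between 1/2 and
    1.\<close>
  have XY: "\<alpha> < Y"
  proof (rule ccontr)
    assume "\<not> \<alpha> < Y"
    hence "int Q * (int P - 1) * (int Y - 1) \<le> int Q * (int P - 1) * (int \<alpha> - 1)"
      using P by (intro mult_left_mono) auto
    also have "\<dots> < int P * (int Q - 1) * (int \<alpha> - 1)"
      using P Y15 \<open>\<not> \<alpha> < Y\<close> by (intro mult_strict_right_mono) (auto simp: algebra_simps)
    finally show False using r by simp
  qed
  have YX: "Y \<le> 2 * \<alpha>"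
  proof (rule ccontr)
    assume "\<not> Y \<le> 2 * \<alpha>"
    hence "2 * int \<alpha> < int Y" by simp
    hence *: "2 * (int \<alpha> - 1) < int Y - 1" by (simp add: algebra_simps)
    have "2 * (int Q * (int P - 1)) \<ge> int P * (int Q - 1)"
    proof -
      have "(int P - 2) * int Q + int P \<ge> 0" using P by auto
      thus ?thesis by (simp add: algebra_simps)
    qed
    hence "int P * (int Q - 1) * (int \<alpha> - 1) \<le> 2 * (int Q * (int P - 1)) * (int \<alpha> - 1)"
      using \<alpha> by (intro mult_right_mono) auto
    also have "\<dots> = int Q * (int P - 1) * (2 * (int \<alpha> - 1))" by simp
    also have "\<dots> < int Q * (int P - 1) * (int Y - 1)"
      using * P by (intro mult_strict_left_mono) auto
    finally show False using r by simp
  qed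
  have u0: "u > 0" using u by simp
  have v0: "v > 0"
  proof (rule ccontr)
    assume "\<not> v > 0"
    hence "repunit \<alpha> u = 0" using eq by simp
    thus False using u0 \<alpha> by (cases u) (auto simp: repunit_Suc)
  qed
  have "\<alpha> ^ (u - 1) < 2 * Y ^ (v - 1)"
  proof -
    have "\<alpha> ^ (u - 1) \<le> repunit \<alpha> u" using repunit_Suc'[of \<alpha> "u - 1"] u0 by simp
    also have "\<dots> = repunit Y v" by (rule eq)
    also have "\<dots> < 2 * Y ^ (v - 1)"
    proof -
      have "int (repunit Y v) * (int Y - 1) < 2 * int Y ^ (v - 1) * (int Y - 1)"
      proof -
        have "int Y ^ v = int Y * int Y ^ (v - 1)" using v0 by (cases v) auto
        moreover have "int Y ^ (v - 1) * int Y \<ge> int Y ^ (v - 1) * 2"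
          using Y15 by (intro mult_left_mono) auto
        ultimately show ?thesis using repunit_power_eq_int[of Y v] by (simp add: algebra_simps)
      qed
      hence "int (repunit Y v) < 2 * int Y ^ (v - 1)"
        by (rule mult_right_less_imp_less) (use Y15 in auto)
      thus ?thesis by (metis of_nat_less_iff of_nat_mult of_nat_numeral of_nat_power)
    qed
    finally show ?thesis .
  qed
  moreover have "Y ^ (u - 1) \<le> 2 ^ (u - 1) * \<alpha> ^ (u - 1)"
    using power_mono[OF YX, of "u - 1"] by (simp add: power_mult_distrib)
  ultimately have "Y ^ (u - 1) < 2 ^ (u - 1) * (2 * Y ^ (v - 1))"
    by (meson le_less_trans mult_less_cancel1 zero_less_numeral zero_less_power)
  also have "\<dots> = 2 ^ u * Y ^ (v - 1)" using u0 by (cases u) auto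
  finally have less: "Y ^ (u - 1) < 2 ^ u * Y ^ (v - 1)" .
  \<comment> \<open>If \<open>u > v\<close>, then \<open>Y ^ (u - v) < 2 ^ u\<close> and
    \<open>Y \<ge> 2 ^ 15\<close> give \<open>15 * (u - v) < u\<close>.\<close>
  have uv: "14 * u < 15 * v"
  proof (cases "u \<le> v")
    case False
    have "Y ^ (u - v) * Y ^ (v - 1) = Y ^ (u - 1)"
      using False v0 by (simp flip: power_add)
    hence "Y ^ (u - v) < 2 ^ u" using less Y15 by (metis mult_less_cancel2)
    moreover have "(2 ^ 15) ^ (u - v) \<le> Y ^ (u - v)" using Y15 by (intro power_mono) auto
    ultimately have "(2::nat) ^ (15 * (u - v)) < 2 ^ u" unfolding power_mult by linarith
    hence "15 * (u - v) < u" by simp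
    thus ?thesis using False by simp
  qed (use u0 in auto)
  \<comment> \<open>The two hypotheses \<open>ratio\<close> and \<open>eq\<close> combine to
    \<open>R (\<alpha> ^ u - 1) = Q (P - 1) (Y ^ v - 1)\<close>, and the constant left over is
    \<open>R - Q (P - 1) = Q - P\<close>.\<close>
  define R c where "R = P * (Q - 1)" and "c = Q - P"
  have "int R * int \<alpha> ^ u = int Q * (int P - 1) * int Y ^ v + int c"
  proof -
    have "int P * (int Q - 1) * (int \<alpha> ^ u - 1) = int P * (int Q - 1) * (int \<alpha> - 1) * int (repunit \<alpha> u)"
      unfolding repunit_power_eq_int[symmetric] by simp
    also have "\<dots> = int Q * (int P - 1) * (int Y ^ v - 1)"
      unfolding r eq repunit_power_eq_int[symmetric] by simp
    finally show ?thesis using P by (simp add: R_def c_def of_nat_diff algebra_simps)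
  qed
  hence "int (R * \<alpha> ^ u) = int (Q * (P - 1) * Y ^ v + c)" using P by (simp add: of_nat_diff)
  hence RX: "R * \<alpha> ^ u = Q * (P - 1) * Y ^ v + c" by (simp only: of_nat_eq_iff)
  have close: "[R * \<alpha> ^ u = c] (mod Q ^ (a * v))"
    unfolding RX Y by (simp add: cong_def power_mult)
  have R: "0 < c" "c < R" "R \<le> Q ^ 2"
  proof -
    show "0 < c" using P by (simp add: c_def)
    have "2 * (Q - 1) \<le> R" unfolding R_def using P by (intro mult_right_mono) auto
    thus "c < R" using P by (simp add: c_def)
    have "R \<le> Q * Q" unfolding R_def using P by (intro mult_mono) auto
    thus "R \<le> Q ^ 2" by (simp add: power2_eq_square)
  qed
  have "\<exists>m. Q ^ m \<le> u \<and> u < Q ^ Suc m" using ex_power_ivl1[of Q u] P u0 by auto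
  then obtain m where m: "Q ^ m \<le> u" "u < Q ^ Suc m" by blast
  have "Q ^ a < Q ^ Suc m" using u m(2) Y by linarith
  hence am: "a \<le> m" using P power_strict_increasing_iff[of Q a "Suc m"] by (simp del: power_Suc)
  \<comment> \<open>The bound \<open>big\<close> propagates from \<open>a\<close> to
    \<open>m\<close>: a step multiplies the square by at most 3 and the power by
    \<open>Q \<ge> 3\<close>.\<close>
  have "2625 * (a + k + 2) ^ 2 \<le> Q ^ (a + k)" for k
  proof (induction k)
    case (Suc k)
    have "(a + Suc k + 2) ^ 2 \<le> 3 * (a + k + 2) ^ 2"
    proof -
      define n where "n = a + k + 2"
      have "2 * n \<le> n * n" "1 \<le> n" unfolding n_def by (intro mult_right_mono) auto
      moreover have "(n + 1) * (n + 1) = n * n + 2 * n + 1" by simp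
      ultimately have "(n + 1) * (n + 1) \<le> 3 * (n * n)" by linarith
      moreover have "a + Suc k + 2 = n + 1" by (simp add: n_def)
      ultimately show ?thesis unfolding n_def[symmetric] by (simp only: power2_eq_square)
    qed
    hence "2625 * (a + Suc k + 2) ^ 2 \<le> 3 * (2625 * (a + k + 2) ^ 2)" by linarith
    also have "\<dots> \<le> Q * Q ^ (a + k)" using Suc P by (intro mult_mono) auto
    finally show ?case by simp
  qed (use big Y in simp)
  from this[of "m - a"] have n2: "2625 * (m + 2) ^ 2 \<le> u" using am m(1) by simp
  show False
  proof (rule linear_form_contradiction[of Q \<alpha> a c R u "a * v" "m + 2"])
    \<comment> \<open>The constants match because \<open>15 * 2450 = 14 * 2625\<close>.\<close>
    have "a * (15 * (2450 * (m + 2) ^ 2)) \<le> a * (14 * u)" using n2 by (intro mult_left_mono) auto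
    also have "\<dots> \<le> a * (15 * v)" using uv by (intro mult_left_mono) auto
    finally show "2450 * a * (m + 2) ^ 2 \<le> a * v" by simp
  qed (use P \<alpha> XY Y R close a m n2 in auto)
qed

section \<open>Computation of the small solutions\<close>

text \<open>
  The list argument of \<open>is_repunit\<close> only bounds the recursion depth; integers are used since their binary
  numerals make \<open>code_simp\<close> fast.
\<close>
primrec is_repunit :: "int list \<Rightarrow> int \<Rightarrow> int \<Rightarrow> bool" where
  "is_repunit [] P N \<longleftrightarrow> False"
| "is_repunit (_ # xs) P N \<longleftrightarrow> N = 1 \<or> (N mod P = 1 \<and> is_repunit xs P (N div P))"

lemma is_repunit_repunit: "P \<ge> 2 \<Longrightarrow> 0 < x \<Longrightarrow> x \<le> length xs \<Longrightarrow> is_repunit xs (int P) (int (repunit P x))"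
proof (induction xs arbitrary: x)
  case (Cons b xs)
  show ?case
  proof (cases "x = 1")
    case False
    then obtain y where x: "x = Suc y" "y > 0" using Cons.prems by (cases x) auto
    have "int (repunit P x) = 1 + int P * int (repunit P y)" by (simp add: x repunit_Suc)
    moreover have "(1 + int P * r) mod int P = 1" "(1 + int P * r) div int P = r" for r
      using Cons.prems by auto
    ultimately show ?thesis using Cons.IH[of y] Cons.prems x by auto
  qed simp
qed simp

text \<open>The entries of the list are ignored; its length is the number of digits, so that the
  evaluation stays within binary integers.\<close>

definition repunit_int :: "int \<Rightarrow> int list \<Rightarrow> int" where
  "repunit_int B xs = foldr (\<lambda>_ r. 1 + B * r) xs 0"

text \<open>The first premise is a cheap necessary condition for the digit test. Coprimality
  excludes 8191, a repunit in bases 2 and 90; the exception left is 31, a repunit in bases 2 and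
  5.\<close>

definition small_ok :: "int \<Rightarrow> int \<Rightarrow> int \<Rightarrow> bool" where
  "small_ok N Q P \<longleftrightarrow> ((N - 1) mod P = 0 \<longrightarrow> gcd P Q = 1 \<longrightarrow> is_repunit [1..20] P N \<longrightarrow> P = 2 \<and> Q = 5)"

definition small_row :: "int \<Rightarrow> int \<Rightarrow> int \<Rightarrow> bool" where
  "small_row N Q b \<longleftrightarrow> list_all (small_ok N Q) [2..b]"

text \<open>The ranges of this and the next tables are what
  \<open>Q ^ a < 2625 * (a + 2) ^ 2\<close> leaves over for \<open>a\<close> from 2 to 11; the list
  \<open>[0..a]\<close> stands for \<open>a + 1\<close> digits. The restriction to bases up to 34 is
  justified in \<open>repunit_small\<close>.\<close>

lemma small_repunits_2a: "list_all (\<lambda>Q. small_row (repunit_int Q [0..2]) Q (min 34 (Q - 1))) [3..100]"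
  by code_simp

lemma small_repunits_2b: "list_all (\<lambda>Q. small_row (repunit_int Q [0..2]) Q 34) [101..204]"
  by code_simp

lemma small_repunits_3: "list_all (\<lambda>Q. small_row (repunit_int Q [0..3]) Q (Q - 1)) [3..40]"
  by code_simp

lemma small_repunits_4: "list_all (\<lambda>Q. small_row (repunit_int Q [0..4]) Q (Q - 1)) [3..17]"
  by code_simp

lemma small_repunits_5: "list_all (\<lambda>a. list_all (\<lambda>Q. small_row (repunit_int Q [0..a]) Q (Q - 1)) [3..10]) [5..11]"
  by code_simp

lemma five_power_mod_256: "list_all (\<lambda>r. (5::nat) ^ r mod 256 = 253 \<longrightarrow> r = 35) [0..<64]"
  by (simp add: upt_conv_Cons)

lemma list_all_uptoD: "list_all R [i..j] \<Longrightarrow> i \<le> x \<Longrightarrow> x \<le> j \<Longrightarrow> R x"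
  by (simp add: list_all_iff)

lemma list_all_uptD: "list_all R [i..<j] \<Longrightarrow> i \<le> x \<Longrightarrow> x < j \<Longrightarrow> R x"
  by (simp add: list_all_iff)

text \<open>
  The equation says \<open>2 ^ (x + 2) = 5 ^ y + 3\<close>. For \<open>x \<ge> 6\<close> it implies \<open>y \<equiv> 35\<close> modulo 64, which is
  impossible modulo 257.
\<close>
lemma repunit_2_5:
  assumes "repunit 2 x = repunit 5 y" "2 \<le> x" "2 \<le> y"
  shows "x = 5"
proof -
  have e: "2 ^ (x + 2) = 5 ^ y + (3::nat)"
  proof -
    have "int 2 ^ x - 1 = int (repunit 5 y)" using repunit_power_eq_int[of 2 x] assms by simp
    moreover have "4 * int (repunit 5 y) = int 5 ^ y - 1" using repunit_power_eq_int[of 5 y] by simp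
    ultimately have "int (2 ^ (x + 2)) = int (5 ^ y + 3)" by (simp add: power_add)
    thus ?thesis by (simp only: of_nat_eq_iff)
  qed
  show ?thesis
  proof (cases "x \<le> 5")
    case True
    hence "x = 2 \<or> x = 3 \<or> x = 4 \<or> x = 5" using assms(2) by auto
    moreover have "(5::nat) dvd 5 ^ y" using assms(3) by (intro dvd_power) auto
    then obtain t where "(5::nat) ^ y = 5 * t" by (rule dvdE)
    hence "(2 ^ (x + 2)) mod 5 = (3::nat)" unfolding e by simp
    ultimately show ?thesis by auto
  next
    case False
    define k where "k = x - 6"
    have x: "x + 2 = 8 + k" using False by (simp add: k_def)
    have "256 dvd (5::nat) ^ y + 3" unfolding e[symmetric] x power_add by simp
    moreover have "z mod 256 = 253" if dv: "256 dvd z + 3" for z :: nat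
    proof -
      obtain m where "z + 3 = 256 * m" using dv by (rule dvdE)
      hence "z = 253 + 256 * (m - 1)" by (cases m) auto
      thus ?thesis by simp
    qed
    ultimately have m: "5 ^ y mod 256 = (253::nat)" by blast
    define r s where "r = y mod 64" and "s = y div 64"
    have y: "y = 64 * s + r" by (simp add: r_def s_def)
    have "[(5::nat) ^ y = 1 ^ s * 5 ^ r] (mod 256)"
      unfolding y power_add power_mult by (intro cong_mult cong_pow cong_refl) (simp add: cong_def)
    hence "5 ^ r mod 256 = (253::nat)" using m by (simp add: cong_def)
    moreover have "r < 64" by (simp add: r_def)
    ultimately have "r = 35" using list_all_uptD[OF five_power_mod_256, of r] by simp
    \<comment> \<open>Modulo 257 the number \<open>5 ^ 64\<close> has order 4 and 2 has order 16, so
      both sides of the equation run through short lists of residues, and these are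
      disjoint.\<close>
    define s0 t where "s0 = s mod 4" and "t = s div 4"
    have s: "s = 4 * t + s0" by (simp add: s0_def t_def)
    have yt: "y = 64 * (4 * t + s0) + 35" using y s \<open>r = 35\<close> by simp
    have y': "(5::nat) ^ y = ((5 ^ 64) ^ 4) ^ t * (5 ^ 64) ^ s0 * 5 ^ 35"
      unfolding yt power_add power_mult by (rule refl)
    have "[(5::nat) ^ 64 = 16] (mod 257)" "[(5::nat) ^ 35 = 14] (mod 257)" by (simp_all add: cong_def)
    hence "[(5::nat) ^ y = (16 ^ 4) ^ t * 16 ^ s0 * 14] (mod 257)"
      unfolding y' by (intro cong_mult cong_pow)
    moreover have "[(16::nat) ^ 4 = 1] (mod 257)" by (simp add: cong_def)
    hence "[((16::nat) ^ 4) ^ t * 16 ^ s0 * 14 = 1 ^ t * 16 ^ s0 * 14] (mod 257)"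
      by (intro cong_mult cong_pow cong_refl)
    ultimately have "[(5::nat) ^ y = 1 ^ t * 16 ^ s0 * 14] (mod 257)" by (rule cong_trans)
    hence "[(5::nat) ^ y + 3 = 1 ^ t * 16 ^ s0 * 14 + 3] (mod 257)"
      by (rule cong_add) (rule cong_refl)
    hence *: "(5 ^ y + 3) mod 257 = (16 ^ s0 * 14 + 3) mod (257::nat)"
      unfolding cong_def power_one mult_1 .
    have "s0 < 4" by (simp add: s0_def)
    hence "s0 = 0 \<or> s0 = 1 \<or> s0 = 2 \<or> s0 = 3" by auto
    hence "(16 ^ s0 * 14 + 3) mod 257 \<in> {17, 227, 246, 36 :: nat}" by (elim disjE) simp_all
    hence A: "(5 ^ y + 3) mod 257 \<in> {17, 227, 246, 36 :: nat}" by (simp only: *)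
    define n0 n1 where "n0 = (x + 2) mod 16" and "n1 = (x + 2) div 16"
    have xn: "x + 2 = 16 * n1 + n0" by (simp add: n0_def n1_def)
    have x': "(2::nat) ^ (x + 2) = (2 ^ 16) ^ n1 * 2 ^ n0"
      unfolding xn power_add power_mult by (rule refl)
    have "[(2::nat) ^ 16 = 1] (mod 257)" by (simp add: cong_def)
    hence "[(2::nat) ^ (x + 2) = 1 ^ n1 * 2 ^ n0] (mod 257)"
      unfolding x' by (intro cong_mult cong_pow cong_refl)
    hence **: "2 ^ (x + 2) mod 257 = 2 ^ n0 mod (257::nat)" by (simp add: cong_def)
    have "n0 \<in> set [0..<16]" by (simp add: n0_def)
    hence "n0 \<in> {0,1,2,3,4,5,6,7,8,9,10,11,12,13,14,15}" by (simp add: upt_conv_Cons eval_nat_numeral del: set_upt)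
    hence "2 ^ (x + 2) mod 257 \<in> {1,2,4,8,16,32,64,128,256,255,253,249,241,225,193,129::nat}"
      unfolding ** by auto
    moreover have "w \<notin> {1,2,4,8,16,32,64,128,256,255,253,249,241,225,193,129}"
      if "w \<in> {17, 227, 246, 36}" for w :: nat
      using that by auto
    ultimately show ?thesis using A unfolding e by blast
  qed
qed

lemma repunit_le_double:
  assumes "B \<ge> 2" shows "repunit B (Suc n) \<le> 2 * B ^ n"
proof (induction n)
  case (Suc n)
  have "repunit B (Suc (Suc n)) \<le> 2 * B ^ n + B ^ Suc n" using Suc repunit_Suc'[of B "Suc n"] by linarith
  moreover have "2 * B ^ n \<le> B ^ Suc n" using assms by simp
  ultimately show ?case by linarith
qed simp

lemma int_repunit: "int (repunit B (length xs)) = repunit_int (int B) xs"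
  by (induction xs) (auto simp: repunit_int_def repunit_Suc)

lemma repunit_small:
  assumes P: "2 \<le> P" "P < Q" "coprime P Q" and a: "2 \<le> a" and eq: "repunit P x = repunit Q (Suc a)"
    and small: "Q ^ a < 2625 * (a + 2) ^ 2"
  shows "P = 2 \<and> Q = 5"
proof -
  have "a \<le> 11"
  proof (rule ccontr)
    assume "\<not> a \<le> 11"
    \<comment> \<open>The induction starts with
      \<open>2625 * 14 ^ 2 = 514500 < 531441 = 3 ^ 12\<close>.\<close>
    have "2625 * (12 + k + 2) ^ 2 \<le> (3::nat) ^ (12 + k)" for k
    proof (induction k)
      case (Suc k)
      define n where "n = 12 + k + 2"
      have "2 * n \<le> n * n" "1 \<le> n" unfolding n_def by (intro mult_right_mono) auto
      moreover have "(n + 1) * (n + 1) = n * n + 2 * n + 1" by simp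
      ultimately have "(n + 1) * (n + 1) \<le> 3 * (n * n)" by linarith
      moreover have "12 + Suc k + 2 = n + 1" by (simp add: n_def)
      moreover have "2625 * (n * n) \<le> 3 ^ (12 + k)"
        using Suc by (simp only: n_def power2_eq_square)
      moreover have "(3::nat) ^ (12 + Suc k) = 3 * 3 ^ (12 + k)" by (simp only: add_Suc_right power_Suc)
      moreover have "2625 * ((n + 1) * (n + 1)) \<le> 2625 * (3 * (n * n))"
        using \<open>(n + 1) * (n + 1) \<le> 3 * (n * n)\<close> by (rule mult_left_mono) simp
      ultimately show ?case unfolding power2_eq_square \<open>12 + Suc k + 2 = n + 1\<close> by linarith
    qed simp
    from this[of "a - 12"] \<open>\<not> a \<le> 11\<close> have "2625 * (a + 2) ^ 2 \<le> 3 ^ a" by simp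
    also have "\<dots> \<le> Q ^ a" using P by (intro power_mono) auto
    finally show False using small by simp
  qed
  hence "a \<in> {2,3,4,5,6,7,8,9,10,11}" using a by (auto simp: numeral_eq_Suc le_Suc_eq)
  have x0: "x > 0" using eq repunit_Suc[of Q a] by (cases x) auto
  \<comment> \<open>Since \<open>a \<le> 11\<close>, the repunit is below
    \<open>2 * 2625 * 13 ^ 2 < 2 ^ 20\<close>; this is why lists of length 20 suffice in
    \<open>small_ok\<close>.\<close>
  have "repunit P x < 2 ^ 20"
  proof -
    have "repunit P x \<le> 2 * Q ^ a" unfolding eq using P by (intro repunit_le_double) auto
    moreover have "(a + 2) ^ 2 \<le> 13 ^ 2" using \<open>a \<le> 11\<close> by (intro power_mono) auto
    ultimately show ?thesis using small by simp
  qed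
  moreover have "2 ^ (x - 1) \<le> repunit P x"
  proof -
    have "2 ^ (x - 1) \<le> P ^ (x - 1)" using P by (intro power_mono) auto
    thus ?thesis using repunit_Suc'[of P "x - 1"] x0 by simp
  qed
  ultimately have "(2::nat) ^ (x - 1) < 2 ^ 20" by linarith
  hence "x - 1 < 20" by (rule power_less_imp_less_exp[rotated]) simp
  hence "x \<le> 20" by simp
  have is_repunit: "is_repunit [1..20] (int P) (int (repunit P x))"
    using P x0 \<open>x \<le> 20\<close> by (intro is_repunit_repunit) simp_all
  have len: "length [0..int a] = Suc a" by simp
  have N: "int (repunit P x) = repunit_int (int Q) [0..int a]"
    using int_repunit[of Q "[0..int a]"] len eq by simp
  have d: "(int (repunit P x) - 1) mod int P = 0"
    using repunit_Suc[of P "x - 1"] x0 by simp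
  have g: "gcd (int P) (int Q) = 1" using P by simp
  have fin: ?thesis if "small_ok (repunit_int (int Q) [0..int a]) (int Q) (int P)"
  proof -
    have "int P = 2 \<and> int Q = 5"
      using that is_repunit d g unfolding small_ok_def N[symmetric] by blast
    thus ?thesis by simp
  qed
  have row: "small_ok N (int Q) (int P)" if "small_row N (int Q) b" "int P \<le> b" for N b
  proof -
    have "list_all (small_ok N (int Q)) [2..b]" using that(1) by (simp only: small_row_def)
    from list_all_uptoD[OF this, of "int P"] show ?thesis using that(2) P by simp
  qed
  consider "a = 2" | "a = 3" | "4 \<le> a" using a by linarith
  thus ?thesis
  proof cases
    case 1
    have Q: "Q \<le> 204"
    proof (rule ccontr)
      assume "\<not> Q \<le> 204"
      hence "205 ^ 2 \<le> Q ^ 2" by (intro power_mono) auto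
      thus False using small 1 by simp
    qed
    have "x \<noteq> 0" "x \<noteq> 1" "x \<noteq> 2" "x \<noteq> 3"
    proof -
      have "repunit P 3 < repunit Q 3" using P by (simp add: repunit_def eval_nat_numeral add_less_mono mult_strict_mono)
      hence "\<not> x \<le> 3"
        using eq 1 repunit_strict_mono[of P x 3] P by (cases "x = 3") (auto simp: eval_nat_numeral)
      thus "x \<noteq> 0" "x \<noteq> 1" "x \<noteq> 2" "x \<noteq> 3" by auto
    qed
    hence "x \<ge> 4" by linarith
    \<comment> \<open>The smaller base needs at least four digits, and \<open>35 ^ 3\<close> already
      exceeds \<open>1 + 204 + 204 ^ 2\<close>.\<close>
    have "P \<le> 34"
    proof (rule ccontr)
      assume "\<not> P \<le> 34"
      have "repunit Q (Suc a) = 1 + Q * (1 + Q)" using 1 by (simp add: repunit_Suc eval_nat_numeral)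
      also have "\<dots> \<le> 1 + 204 * (1 + 204)" using Q by (intro add_mono mult_mono) auto
      also have "\<dots> < 35 ^ 3" by simp
      also have "\<dots> \<le> P ^ 3" using \<open>\<not> P \<le> 34\<close> by (intro power_mono) auto
      also have "\<dots> \<le> P ^ (x - 1)" using P \<open>x \<ge> 4\<close> by (intro power_increasing) auto
      also have "\<dots> \<le> repunit P x" using repunit_Suc'[of P "x - 1"] x0 by simp
      finally show False using eq by simp
    qed
    hence "small_row (repunit_int (int Q) [0..2]) (int Q) (min 34 (int Q - 1))"
    proof (cases "Q \<le> 100")
      case True
      thus ?thesis using list_all_uptoD[OF small_repunits_2a, of "int Q"] P by simp
    next
      case False
      thus ?thesis using list_all_uptoD[OF small_repunits_2b, of "int Q"] Q by simp
    qed
    from row[OF this] show ?thesis using fin 1 P \<open>P \<le> 34\<close> by simp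
  next
    case 2
    have Q: "Q \<le> 40"
    proof (rule ccontr)
      assume "\<not> Q \<le> 40"
      hence "41 ^ 3 \<le> Q ^ 3" by (intro power_mono) auto
      thus False using small 2 by simp
    qed
    hence "small_row (repunit_int (int Q) [0..3]) (int Q) (int Q - 1)"
      using list_all_uptoD[OF small_repunits_3, of "int Q"] P Q by simp
    from row[OF this] show ?thesis using fin 2 P by simp
  next
    case 3
    have Q: "Q \<le> 17" if "a = 4"
    proof (rule ccontr)
      assume "\<not> Q \<le> 17"
      hence "18 ^ a \<le> Q ^ a" by (intro power_mono) auto
      thus False using small that by simp
    qed
    have Q': "Q \<le> 10" if "a \<noteq> 4"
    proof (rule ccontr)
      assume "\<not> Q \<le> 10"
      hence "11 ^ a \<le> Q ^ a" by (intro power_mono) auto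
      moreover have "2625 * (a + 2) ^ 2 \<le> 11 ^ a"
        using that 3 \<open>a \<in> {2,3,4,5,6,7,8,9,10,11}\<close> by auto
      ultimately show False using small by linarith
    qed
    have "small_row (repunit_int (int Q) [0..int a]) (int Q) (int Q - 1)"
    proof (cases "a = 4")
      case True
      thus ?thesis using list_all_uptoD[OF small_repunits_4, of "int Q"] P Q by simp
    next
      case False
      thus ?thesis
        using list_all_uptoD[OF list_all_uptoD[OF small_repunits_5, of "int a"], of "int Q"] P Q' 3 \<open>a \<le> 11\<close> by simp
    qed
    from row[OF this] show ?thesis using fin P by simp
  qed
qed

section \<open>Uniqueness of the solution for two fixed bases\<close>

theorem repunit_eq_unique_less:
  assumes p: "prime p" "prime q" "p \<noteq> q" and PQ: "P = p ^ g" "Q = q ^ h" "g > 0" "h > 0" "P < Q"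
    and sol: "repunit P x = repunit Q y" "2 \<le> x" "2 \<le> y" "repunit P x' = repunit Q y'" "2 \<le> x'" "2 \<le> y'"
  shows "x = x'"
proof -
  define sl where "sl x \<longleftrightarrow> 2 \<le> x \<and> (\<exists>y\<ge>2. repunit P x = repunit Q y)" for x
  define x1 where "x1 = (LEAST x. sl x)"
  have "sl x" using sol by (auto simp: sl_def)
  hence x1: "sl x1" unfolding x1_def by (rule LeastI)
  have least: "x1 \<le> z" if "sl z" for z unfolding x1_def using that by (rule Least_le)
  obtain y1 where y1: "repunit P x1 = repunit Q y1" "2 \<le> y1" using x1 by (auto simp: sl_def)
  have x12: "2 \<le> x1" using x1 by (simp add: sl_def)
  have P2: "2 \<le> P"
    using p(1) PQ prime_ge_2_nat[of p] self_le_power[of p g] by linarith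
  have cop: "coprime P Q" using p by (simp add: PQ primes_coprime)
  have "z = x1" if z: "sl z" for z
  proof (rule ccontr)
    assume "z \<noteq> x1"
    with least[OF z] have z1: "x1 < z" by simp
    obtain w where w: "repunit P z = repunit Q w" "2 \<le> w" using z by (auto simp: sl_def)
    define g1 g2 where "g1 = gcd (x1 - 1) (z - 1)" and "g2 = gcd (y1 - 1) (w - 1)"
    \<comment> \<open>The gcd yields a solution that is not above the minimal one, hence equal to
      it. So the exponents of the minimal solution, each diminished by 1, divide those of any
      other.\<close>
    have g: "repunit P (Suc g1) = repunit Q (Suc g2)"
      unfolding g1_def g2_def using repunit_eq_closure[OF y1(1) w(1)] x12 y1 w z1 by simp
    have gp: "g1 > 0" "g2 > 0" using x12 y1 by (auto simp: g1_def g2_def)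
    have "sl (Suc g1)" using g gp by (auto simp: sl_def intro!: exI[of _ "Suc g2"])
    hence "x1 \<le> Suc g1" by (rule least)
    moreover have "g1 \<le> x1 - 1" unfolding g1_def using x12 by (intro gcd_le1_nat) auto
    ultimately have g1: "Suc g1 = x1" using x12 by simp
    hence g2: "Suc g2 = y1" using g y1 repunit_inj[of Q "Suc g2" y1] PQ(5) by simp
    have "g1 dvd z - 1" "g2 dvd w - 1" by (simp_all add: g1_def g2_def)
    hence "x1 - 1 dvd z - 1" "y1 - 1 dvd w - 1" by (simp_all flip: g1 g2)
    then obtain u v where u: "z - 1 = (x1 - 1) * u" and v: "w - 1 = (y1 - 1) * v"
      by (auto elim!: dvdE)
    define a \<alpha> Y where "a = y1 - 1" and "\<alpha> = P ^ (x1 - 1)" and "Y = Q ^ a"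
    have step: "P * repunit P (i - 1) = Q * repunit Q (j - 1)" if "repunit P i = repunit Q j" "2 \<le> i" "2 \<le> j" for i j
      using that by (cases i; cases j) (auto simp: repunit_Suc)
    have e1: "P * repunit P (x1 - 1) = Q * repunit Q a" unfolding a_def using step[OF y1(1) x12 y1(2)] .
    have rp: "repunit P (x1 - 1) > 0" using x12 repunit_strict_mono[of P 0 "x1 - 1"] P2 by simp
    have rXY: "repunit \<alpha> u = repunit Y v"
    proof -
      have "P * repunit P (z - 1) = Q * repunit Q (w - 1)" using step[OF w(1) _ w(2)] z1 x12 by simp
      hence "(P * repunit P (x1 - 1)) * repunit \<alpha> u = (Q * repunit Q a) * repunit Y v"
        unfolding u v by (simp only: repunit_mult \<alpha>_def Y_def a_def mult.assoc)
      thus ?thesis using rp P2 unfolding e1[symmetric] by simp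
    qed
    \<comment> \<open>For \<open>a = 1\<close> the base \<open>Q\<close> would be a multiple of
      \<open>P\<close>.\<close>
    have a2: "2 \<le> a"
    proof (rule ccontr)
      assume "\<not> 2 \<le> a"
      hence "a = 1" using y1 by (simp add: a_def)
      hence "Q = P * repunit P (x1 - 1)" using e1 by simp
      hence "P dvd Q" by (rule dvdI)
      thus False using cop P2 by (auto dest: coprime_absorb_left)
    qed
    have "Q dvd P * repunit P (x1 - 1)" unfolding e1 by simp
    hence Qd: "Q dvd repunit P (x1 - 1)"
      using cop by (simp add: coprime_dvd_mult_right_iff coprime_commute)
    have XQ: "[\<alpha> = 1] (mod Q)"
    proof -
      from Qd have "int Q dvd (int P - 1) * int (repunit P (x1 - 1))" by simp
      hence "[int \<alpha> = int 1] (mod int Q)" by (simp add: repunit_power_eq_int \<alpha>_def cong_iff_dvd_diff)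
      thus ?thesis by (simp only: cong_int_iff)
    qed
    have X0: "\<alpha> > 0" using P2 by (simp add: \<alpha>_def)
    have u2: "u \<ge> 2"
    proof (rule ccontr)
      assume "\<not> 2 \<le> u"
      hence "(x1 - 1) * u \<le> (x1 - 1) * 1" by (intro mult_left_mono) auto
      hence "z - 1 \<le> x1 - 1" by (simp only: u[symmetric] mult_1_right)
      thus False using z1 x12 by simp
    qed
    have v0: "v > 0" using v w by (cases v) auto
    \<comment> \<open>Dropping the last digit in \<open>rXY\<close> shows that \<open>Y\<close>
      divides \<open>repunit \<alpha> (u - 1)\<close>; lifting the exponent turns this into
      \<open>Y dvd u - 1\<close>, whence \<open>u > Y\<close>.\<close>
    have "\<alpha> * repunit \<alpha> (u - 1) = Y * repunit Y (v - 1)"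
      using rXY u2 v0 by (cases u; cases v) (auto simp: repunit_Suc)
    hence "Y dvd \<alpha> * repunit \<alpha> (u - 1)" by simp
    moreover have "coprime Y \<alpha>" using cop by (simp add: \<alpha>_def Y_def coprime_commute)
    ultimately have "Y dvd repunit \<alpha> (u - 1)" by (simp add: coprime_dvd_mult_right_iff)
    hence "q ^ (h * a) dvd repunit \<alpha> (u - 1)" by (simp add: Y_def PQ power_mult)
    moreover have "[\<alpha> = 1] (mod q)"
      using XQ by (rule cong_dvd_modulus_nat) (simp add: PQ dvd_power)
    moreover have "[\<alpha> = 1] (mod 4)" if q2: "q = 2"
    proof -
      \<comment> \<open>Here \<open>Q = 2 ^ h\<close> is larger than \<open>P \<ge> 2\<close>, so 4
        divides \<open>Q\<close>.\<close>
      have "h \<noteq> 1" using PQ P2 q2 by auto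
      hence "2 \<le> h" using PQ by simp
      hence "2 ^ 2 dvd Q" unfolding PQ q2 by (intro le_imp_power_dvd)
      hence "4 dvd Q" by simp
      with XQ show ?thesis by (rule cong_dvd_modulus_nat)
    qed
    ultimately have "q ^ (h * a) dvd u - 1" using prime_power_dvd_repunit[OF p(2)] by blast
    hence "Y dvd u - 1" by (simp add: Y_def PQ power_mult)
    hence uY: "Y < u" using u2 dvd_imp_le[of Y "u - 1"] by simp
    have ratio: "P * (Q - 1) * (\<alpha> - 1) = Q * (P - 1) * (Y - 1)"
    proof -
      have m: "\<alpha> - 1 = (P - 1) * repunit P (x1 - 1)" "Y - 1 = (Q - 1) * repunit Q a"
      proof -
        have *: "B ^ n - 1 = (B - 1) * repunit B n" if "B \<ge> 1" for B n
        proof -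
          have "int (B ^ n - 1) = int ((B - 1) * repunit B n)"
            using repunit_power_eq_int[of B n] that by (simp add: of_nat_diff)
          thus ?thesis by (simp only: of_nat_eq_iff)
        qed
        show "\<alpha> - 1 = (P - 1) * repunit P (x1 - 1)" "Y - 1 = (Q - 1) * repunit Q a"
          unfolding \<alpha>_def Y_def using P2 PQ(5) by (intro *; simp)+
      qed
      have "P * (Q - 1) * (\<alpha> - 1) = (Q - 1) * (P - 1) * (P * repunit P (x1 - 1))"
        by (simp only: m mult_ac)
      also have "\<dots> = Q * (P - 1) * (Y - 1)" unfolding e1 by (simp only: m mult_ac)
      finally show ?thesis .
    qed
    show False
    proof (cases "2625 * (a + 2) ^ 2 \<le> Y")
      case True
      show False
        by (rule no_large_repunit_solution[OF P2 PQ(5) a2 Y_def XQ X0 ratio rXY uY True])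
    next
      case False
      have "repunit P x1 = repunit Q (Suc a)" using y1 by (simp add: a_def)
      hence "P = 2 \<and> Q = 5" using repunit_small[OF P2 PQ(5) cop a2] False by (simp add: Y_def)
      hence "x1 = 5" "z = 5" using repunit_2_5 y1 w x12 z1 by auto
      thus False using z1 by simp
    qed
  qed
  thus ?thesis using sol by (metis sl_def)
qed

lemma repunit_eq_unique:
  assumes p: "prime p" "prime q" "p \<noteq> q" and PQ: "P = p ^ g" "Q = q ^ h" "g > 0" "h > 0"
    and sol: "repunit P x = repunit Q y" "2 \<le> x" "2 \<le> y" "repunit P x' = repunit Q y'" "2 \<le> x'" "2 \<le> y'"
  shows "x = x'"
proof (cases P Q rule: linorder_cases)
  case less
  thus ?thesis using repunit_eq_unique_less[OF p PQ less sol] by simp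
next
  case equal
  have "p dvd q ^ h" using equal PQ dvd_power[of g p] by simp
  hence "p dvd q" using p(1) by (rule prime_dvd_power[rotated])
  thus ?thesis using p primes_dvd_imp_eq by blast
next
  case greater
  have "y = y'"
    using repunit_eq_unique_less[of q p Q h P g y x y' x'] p PQ sol greater by simp
  thus ?thesis using sol repunit_inj[of P x x'] p PQ prime_gt_0_nat[of p] by simp
qed

text \<open>The gcd of the three relations is a fourth one of the same shape. Dividing the last two
  by it leaves two different equalities of repunits in the bases \<open>p ^ g\<close> and
  \<open>q ^ h\<close>, so \<open>p = q\<close> by uniqueness. Then \<open>g = h\<close> by p-adic
  valuation, and the factors agree.\<close>

lemma prime_power_pairs_eq:
  fixes z z' :: nat
  assumes p: "prime p" "prime q" and z: "z > 0" "z' > 0"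
    and i: "0 < i" "i < i'" "i' < N" and j: "0 < j" "j < j'" "j' < M"
    and e1: "int z * (int p ^ i - 1) = int z' * (int q ^ j - 1)"
    and e2: "int z * (int p ^ i' - 1) = int z' * (int q ^ j' - 1)"
    and e3: "int z * (int p ^ N - 1) = int z' * (int q ^ M - 1)"
  shows "z = z'"
proof -
  define A B where "A = z * (p - 1)" and "B = z' * (q - 1)"
  have pq: "p > 1" "q > 1" using p prime_gt_1_nat by auto
  have AB: "A > 0" "B > 0" using z pq by (auto simp: A_def B_def)
  have conv: "A * repunit p k = B * repunit q l" if "int z * (int p ^ k - 1) = int z' * (int q ^ l - 1)" for k l
  proof -
    have "int (A * repunit p k) = int (B * repunit q l)"
      using that pq unfolding repunit_power_eq_int[symmetric] by (simp add: A_def B_def of_nat_diff mult.assoc)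
    thus ?thesis by (simp only: of_nat_eq_iff)
  qed
  note c = conv[OF e1] conv[OF e2] conv[OF e3]
  define g h where "g = gcd i (gcd i' N)" and "h = gcd j (gcd j' M)"
  have gh0: "g > 0" "h > 0" using i j by (auto simp: g_def h_def)
  have "A * repunit p g = gcd (A * repunit p i) (gcd (A * repunit p i') (A * repunit p N))"
    by (simp add: g_def gcd_repunit flip: gcd_mult_distrib_nat)
  also have "\<dots> = B * repunit q h"
    unfolding c by (simp add: h_def gcd_repunit flip: gcd_mult_distrib_nat)
  finally have gh: "A * repunit p g = B * repunit q h" .
  define P Q where "P = p ^ g" and "Q = q ^ h"
  have rp: "repunit p g > 0" using gh0 pq repunit_strict_mono[of p 0 g] by simp
  have red: "repunit P (k div g) = repunit Q (l div h)"
    if "A * repunit p k = B * repunit q l" "g dvd k" "h dvd l" for k l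
  proof -
    have "repunit p k = repunit p g * repunit P (k div g)" "repunit q l = repunit q h * repunit Q (l div h)"
      using that by (simp_all add: P_def Q_def flip: repunit_mult)
    hence "(A * repunit p g) * repunit P (k div g) = (B * repunit q h) * repunit Q (l div h)"
      using that(1) by (simp add: mult.assoc)
    thus ?thesis using AB rp unfolding gh[symmetric] by simp
  qed
  define s s' t t' where "s = i' div g" and "s' = N div g" and "t = j' div h" and "t' = M div h"
  have gd: "g dvd i" "g dvd i'" "g dvd N" "h dvd j" "h dvd j'" "h dvd M"
    by (auto simp: g_def h_def intro: dvd_trans[OF gcd_dvd2 gcd_dvd1] dvd_trans[OF gcd_dvd2 gcd_dvd2])
  have r: "repunit P s = repunit Q t" "repunit P s' = repunit Q t'"
    using red[OF c(2)] red[OF c(3)] gd by (auto simp: s_def s'_def t_def t'_def)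
  have lt: "a div d < b div d" if "a < b" "d dvd a" "d dvd b" for a b d :: nat
    using that by (auto elim!: dvdE)
  have "0 < i div g" "i div g < s" "s < s'" "0 < j div h" "j div h < t" "t < t'"
    using lt[of 0 i g] lt[of i i' g] lt[of i' N g] lt[of 0 j h] lt[of j j' h] lt[of j' M h] i j gd
    by (auto simp: s_def s'_def t_def t'_def)
  hence st: "2 \<le> s" "s < s'" "2 \<le> t" "t < t'" by auto
  have "p = q"
  proof (rule ccontr)
    assume "p \<noteq> q"
    hence "s = s'"
      using repunit_eq_unique[of p q P g Q h s t s' t'] p gh0 r st by (simp add: P_def Q_def)
    thus False using st by simp
  qed
  have "P * repunit P (s - 1) = Q * repunit Q (t - 1)"
    using r(1) st by (cases s; cases t) (auto simp: repunit_Suc)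
  hence pr: "p ^ g * repunit P (s - 1) = p ^ h * repunit Q (t - 1)"
    by (simp add: P_def Q_def \<open>p = q\<close>)
  \<comment> \<open>Repunits in a base divisible by \<open>p\<close> are prime to \<open>p\<close>,
    so \<open>g\<close> and \<open>h\<close> are the p-adic valuations of the two sides of
    \<open>pr\<close>.\<close>
  have no: "\<not> p dvd repunit (p ^ k) n" if "k > 0" "n > 0" for k n
  proof
    assume "p dvd repunit (p ^ k) n"
    moreover have "p dvd p ^ k" using that by simp
    ultimately have "p dvd 1"
      using coprime_common_divisor[OF coprime_repunit[OF that(2), of "p ^ k"]] by blast
    thus False using pq by simp
  qed
  have "g = h"
  proof (rule ccontr)
    assume "g \<noteq> h"
    then consider "g < h" | "h < g" by linarith
    thus False
    proof cases
      case 1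
      hence "p ^ h = p ^ g * (p * p ^ (h - g - 1))" by (simp flip: power_add power_Suc)
      hence "repunit P (s - 1) = p * p ^ (h - g - 1) * repunit Q (t - 1)" using pr pq by simp
      hence "p dvd repunit P (s - 1)" by simp
      thus False using no[of g "s - 1"] gh0 st by (simp add: P_def)
    next
      case 2
      hence "p ^ g = p ^ h * (p * p ^ (g - h - 1))" by (simp flip: power_add power_Suc)
      hence "p * p ^ (g - h - 1) * repunit P (s - 1) = repunit Q (t - 1)" using pr pq by simp
      hence "p dvd repunit Q (t - 1)" by (metis dvd_triv_left mult.assoc)
      thus False using no[of h "t - 1"] gh0 st by (simp add: Q_def \<open>p = q\<close>)
    qed
  qed
  hence "A = B" using gh rp \<open>p = q\<close> by simp
  thus ?thesis using pq \<open>p = q\<close> by (simp add: A_def B_def)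
qed

section \<open>Centralizers in nilpotent groups\<close>

text \<open>Sets are allowed so that a single relation covers the whole group, single vertices and
  pairs; the empty set gives the group.\<close>

definition centr :: "('a, 'b) monoid_scheme \<Rightarrow> 'a set \<Rightarrow> 'a set" where
  "centr G S = {g \<in> carrier G. \<forall>s \<in> S. s \<otimes>\<^bsub>G\<^esub> g = g \<otimes>\<^bsub>G\<^esub> s}"

context group
begin

lemma centr_subgroup:
  assumes "S \<subseteq> carrier G" shows "subgroup (centr G S) G"
proof (rule subgroupI)
  show "centr G S \<subseteq> carrier G" by (auto simp: centr_def)
  have "\<one> \<in> centr G S" using assms by (auto simp: centr_def)
  thus "centr G S \<noteq> {}" by blast
next
  fix a assume a: "a \<in> centr G S"
  have "s \<otimes> inv a = inv a \<otimes> s" if s: "s \<in> S" for s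
  proof -
    have [simp]: "s \<in> carrier G" "a \<in> carrier G" and c: "s \<otimes> a = a \<otimes> s"
      using s a assms by (auto simp: centr_def)
    have "s \<otimes> inv a = inv a \<otimes> (a \<otimes> s) \<otimes> inv a" by (simp add: m_assoc[symmetric])
    also have "\<dots> = inv a \<otimes> s" by (simp add: c[symmetric] m_assoc)
    finally show ?thesis .
  qed
  thus "inv a \<in> centr G S" using a by (auto simp: centr_def)
next
  fix a b assume ab: "a \<in> centr G S" "b \<in> centr G S"
  have "s \<otimes> (a \<otimes> b) = a \<otimes> b \<otimes> s" if s: "s \<in> S" for s
  proof -
    have [simp]: "s \<in> carrier G" "a \<in> carrier G" "b \<in> carrier G"
      and c: "s \<otimes> a = a \<otimes> s" "s \<otimes> b = b \<otimes> s"
      using s ab assms by (auto simp: centr_def)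
    have "s \<otimes> (a \<otimes> b) = a \<otimes> (s \<otimes> b)" by (simp add: c(1) flip: m_assoc)
    thus ?thesis by (simp add: c(2) m_assoc)
  qed
  thus "a \<otimes> b \<in> centr G S" using ab by (auto simp: centr_def)
qed

lemma center_eq_centr: "center G = centr G (carrier G)"
  by (auto simp: center_def centr_def)

lemma centr_Un: "centr G (S \<union> T) = centr G S \<inter> centr G T"
  by (auto simp: centr_def)

lemma centr_empty: "centr G {} = carrier G"
  by (simp add: centr_def)

lemma center_subset_centr: "S \<subseteq> carrier G \<Longrightarrow> center G \<subseteq> centr G S"
  by (auto simp: center_def centr_def)

lemma card_subgroup_dvd:
  assumes "subgroup A G" "subgroup B G" "A \<subseteq> B" "finite (carrier G)"
  shows "card A dvd card B"
proof -
  have "subgroup A (G\<lparr>carrier := B\<rparr>)" using assms by (simp add: subgroup_incl)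
  moreover have "group (G\<lparr>carrier := B\<rparr>)" using assms(2) by (simp add: subgroup_imp_group)
  ultimately have "card (rcosets\<^bsub>G\<lparr>carrier := B\<rparr>\<^esub> A) * card A = Coset.order (G\<lparr>carrier := B\<rparr>)"
    by (simp add: group.lagrange)
  hence "card B = card (rcosets\<^bsub>G\<lparr>carrier := B\<rparr>\<^esub> A) * card A" by (simp add: Coset.order_def)
  thus ?thesis by (rule dvdI[of _ _ "card (rcosets\<^bsub>G\<lparr>carrier := B\<rparr>\<^esub> A)", OF trans[OF _ mult.commute]])
qed

lemma card_subgroup_pos: "subgroup A G \<Longrightarrow> finite (carrier G) \<Longrightarrow> card A > 0"
  using subgroup.one_closed subgroup.subset by (metis card_gt_0_iff empty_iff finite_subset)

text \<open>The fibres of the multiplication map on \<open>A \<times> B\<close> have at most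
  \<open>card (A \<inter> B)\<close> elements: if \<open>a b = a0 b0\<close>, then
  \<open>inv a0 \<otimes> a = b0 \<otimes> inv b\<close> lies in both subgroups and determines the
  pair.\<close>

lemma card_mult_le:
  assumes A: "subgroup A G" and B: "subgroup B G" and fin: "finite (carrier G)"
  shows "card A * card B \<le> card (carrier G) * card (A \<inter> B)"
proof -
  note sub = subgroup.subset[OF A] subgroup.subset[OF B]
  have finAB: "finite A" "finite B" using sub fin finite_subset by auto
  define F where "F g = {(a, b). a \<in> A \<and> b \<in> B \<and> a \<otimes> b = g}" for g
  have fib: "card (F g) \<le> card (A \<inter> B)" for g
  proof (cases "F g = {}")
    case False
    then obtain a0 b0 where ab0: "a0 \<in> A" "b0 \<in> B" "a0 \<otimes> b0 = g" by (auto simp: F_def)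
    show ?thesis
    proof (rule card_inj_on_le[where f = "\<lambda>(a, b). inv a0 \<otimes> a"])
      show "inj_on (\<lambda>(a, b). inv a0 \<otimes> a) (F g)"
      proof (rule inj_onI, clarify)
        fix a b a' b'
        assume *: "(a, b) \<in> F g" "(a', b') \<in> F g" "inv a0 \<otimes> a = inv a0 \<otimes> a'"
        hence c: "a \<in> carrier G" "a' \<in> carrier G" "b \<in> carrier G" "b' \<in> carrier G" "a0 \<in> carrier G"
          using sub ab0 by (auto simp: F_def)
        have "a = a'" using *(3) c by simp
        moreover have "a \<otimes> b = a' \<otimes> b'" using * by (simp add: F_def)
        ultimately show "a = a' \<and> b = b'" using c by simp
      qed
      show "(\<lambda>(a, b). inv a0 \<otimes> a) ` F g \<subseteq> A \<inter> B"
      proof clarify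
        fix a b assume "(a, b) \<in> F g"
        hence ab: "a \<in> A" "b \<in> B" "a \<otimes> b = a0 \<otimes> b0" using ab0 by (auto simp: F_def)
        have c: "a \<in> carrier G" "b \<in> carrier G" "a0 \<in> carrier G" "b0 \<in> carrier G"
          using ab ab0 sub by auto
        have "inv a0 \<otimes> a = inv a0 \<otimes> (a \<otimes> b) \<otimes> inv b" using c by (simp add: m_assoc)
        also have "\<dots> = b0 \<otimes> inv b" unfolding ab(3) using c by (simp add: m_assoc[symmetric])
        finally have "inv a0 \<otimes> a = b0 \<otimes> inv b" .
        moreover have "inv a0 \<otimes> a \<in> A" using A ab ab0 by (simp add: subgroup.m_closed subgroup.m_inv_closed)
        moreover have "b0 \<otimes> inv b \<in> B" using B ab ab0 by (simp add: subgroup.m_closed subgroup.m_inv_closed)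
        ultimately show "inv a0 \<otimes> a \<in> A \<inter> B" by simp
      qed
      show "finite (A \<inter> B)" using finAB by simp
    qed
  qed simp
  have "A \<times> B \<subseteq> (\<Union>g\<in>carrier G. F g)"
    using sub by (auto simp: F_def subset_iff)
  moreover have "finite (F g)" for g
    by (rule finite_subset[of _ "A \<times> B"]) (use finAB in \<open>auto simp: F_def\<close>)
  ultimately have "card (A \<times> B) \<le> card (\<Union>g\<in>carrier G. F g)" using fin by (intro card_mono) auto
  also have "\<dots> \<le> (\<Sum>g\<in>carrier G. card (F g))" by (rule card_UN_le[OF fin])
  also have "\<dots> \<le> (\<Sum>g\<in>carrier G. card (A \<inter> B))" by (intro sum_mono fib)
  finally show ?thesis by (simp add: card_cartesian_product)
qed

lemma normal_lower_central: "lower_central G n \<lhd> G"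
proof (induction n)
  case 0
  show ?case by (simp add: normal_invI subgroup_self)
next
  case (Suc n)
  have sub: "lower_central G n \<subseteq> carrier G" using Suc normal_imp_subgroup subgroup.subset by blast
  show ?case
    unfolding lower_central.simps
  proof (rule normal_generateI)
    fix h g assume "h \<in> {x \<otimes> y \<otimes> inv x \<otimes> inv y | x y. x \<in> lower_central G n \<and> y \<in> carrier G}" and g: "g \<in> carrier G"
    then obtain x y where xy: "x \<in> lower_central G n" "y \<in> carrier G" "h = x \<otimes> y \<otimes> inv x \<otimes> inv y" by blast
    have xc: "x \<in> carrier G" using xy sub by auto
    define x' y' where "x' = g \<otimes> x \<otimes> inv g" and "y' = g \<otimes> y \<otimes> inv g"
    have "x' \<in> lower_central G n"
      unfolding x'_def using Suc xy g by (simp add: normal.inv_op_closed2)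
    moreover have "y' \<in> carrier G" using g xy by (simp add: y'_def)
    moreover have "g \<otimes> h \<otimes> inv g = x' \<otimes> y' \<otimes> inv x' \<otimes> inv y'"
    proof -
      have "inv g \<otimes> (g \<otimes> z) = z" if "z \<in> carrier G" for z
        using g that by (simp add: m_assoc[symmetric])
      thus ?thesis using g xc xy by (simp add: x'_def y'_def inv_mult_group m_assoc)
    qed
    ultimately show "g \<otimes> h \<otimes> inv g \<in> {x \<otimes> y \<otimes> inv x \<otimes> inv y | x y. x \<in> lower_central G n \<and> y \<in> carrier G}"
      by blast
  qed (use sub in auto)
qed

section \<open>Commuting of elements of coprime orders\<close>

lemma central_commutator_pow:
  assumes [simp]: "a \<in> carrier G" "b \<in> carrier G" "c \<in> carrier G"
    and ab: "a \<otimes> b = c \<otimes> (b \<otimes> a)" and ca: "c \<otimes> a = a \<otimes> c"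
  shows "a [^] (j::nat) \<otimes> b = c [^] j \<otimes> (b \<otimes> a [^] j)"
proof (induction j)
  case (Suc j)
  have cj: "a \<otimes> c [^] j = c [^] j \<otimes> a"
    using group_commutes_pow[of c a j] ca by simp
  have aj: "a [^] Suc j = a \<otimes> a [^] j" by (rule nat_pow_Suc2) simp
  have "a [^] Suc j \<otimes> b = a \<otimes> (a [^] j \<otimes> b)" unfolding aj by (simp add: m_assoc)
  also have "\<dots> = (a \<otimes> c [^] j) \<otimes> (b \<otimes> a [^] j)" unfolding Suc by (simp add: m_assoc)
  also have "\<dots> = c [^] j \<otimes> ((a \<otimes> b) \<otimes> a [^] j)" unfolding cj by (simp add: m_assoc)
  also have "\<dots> = c [^] j \<otimes> c \<otimes> (b \<otimes> (a \<otimes> a [^] j))" unfolding ab by (simp add: m_assoc)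
  also have "\<dots> = c [^] Suc j \<otimes> (b \<otimes> a [^] Suc j)" unfolding aj by simp
  finally show ?case .
qed simp

text \<open>The commutator \<open>c\<close> commutes with both elements, so
  \<open>a [^] m = \<one>\<close> forces \<open>c [^] m = \<one>\<close>. Exchanging the roles of
  \<open>a\<close> and \<open>b\<close> replaces \<open>c\<close> by its inverse, so the order of
  \<open>c\<close> divides \<open>n\<close> too.\<close>

lemma central_commutator_eq_one:
  assumes c: "a \<in> carrier G" "b \<in> carrier G" "c \<in> carrier G"
    and ab: "a \<otimes> b = c \<otimes> (b \<otimes> a)" and ca: "c \<otimes> a = a \<otimes> c" and cb: "c \<otimes> b = b \<otimes> c"
    and m: "a [^] (m::nat) = \<one>" and n: "b [^] (n::nat) = \<one>" and cop: "coprime m n"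
  shows "c = \<one>"
proof -
  have "c [^] m = \<one>" using central_commutator_pow[OF c ab ca, of m] c m by simp
  moreover have "inv c [^] n = \<one>"
  proof -
    have "b \<otimes> a = inv c \<otimes> (a \<otimes> b)" unfolding ab using c by (simp add: m_assoc[symmetric])
    moreover have "inv c \<otimes> b = b \<otimes> inv c"
      using c cb by (metis inv_solve_left inv_solve_right m_assoc m_closed inv_closed)
    ultimately show ?thesis
      using central_commutator_pow[of b a "inv c" n] c n by simp
  qed
  hence "c [^] n = \<one>" using c by (simp add: nat_pow_inv)
  ultimately have "ord c dvd m" "ord c dvd n" using c by (simp_all add: pow_eq_id)
  hence "ord c = 1" using cop by (metis coprime_common_divisor nat_dvd_1_iff_1)
  thus ?thesis using c by (metis nat_pow_eone pow_ord_eq_1)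
qed

text \<open>
  The commutator descends the lower central series: modulo the next term it is central, and its order
  divides both \<open>m\<close> and \<open>n\<close>.
\<close>
lemma coprime_order_commute:
  assumes nil: "lower_central G k = {\<one>}" and xy: "x \<in> carrier G" "y \<in> carrier G"
    and m: "x [^] (m::nat) = \<one>" and n: "y [^] (n::nat) = \<one>" and cop: "coprime m n"
  shows "x \<otimes> y = y \<otimes> x"
proof -
  define c where "c = x \<otimes> y \<otimes> inv x \<otimes> inv y"
  have cc: "c \<in> carrier G" using xy by (simp add: c_def)
  have cxy: "x \<otimes> y = c \<otimes> (y \<otimes> x)" using xy by (simp add: c_def m_assoc inv_solve_left')
  have "c \<in> lower_central G j" for j
  proof (induction j)
    case (Suc j)
    define N where "N = lower_central G (Suc j)"
    interpret N: normal N G unfolding N_def by (rule normal_lower_central)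
    interpret Q: group "G Mod N" by (rule N.factorgroup_is_group)
    define \<pi> where "\<pi> g = N #> g" for g
    have \<pi>h: "\<pi> \<in> hom G (G Mod N)" using N.r_coset_hom_Mod by (simp add: \<pi>_def[abs_def])
    interpret \<pi>: group_hom G "G Mod N" \<pi> by unfold_locales (rule \<pi>h)
    have one: "\<pi> g = \<one>\<^bsub>G Mod N\<^esub> \<longleftrightarrow> g \<in> N" if "g \<in> carrier G" for g
      using that by (auto simp: \<pi>_def FactGroup_def rcos_self coset_join2 N.subgroup_axioms N.is_subgroup
          dest: rcos_self[OF _ N.is_subgroup])
    have com: "\<pi> c \<otimes>\<^bsub>G Mod N\<^esub> \<pi> g = \<pi> g \<otimes>\<^bsub>G Mod N\<^esub> \<pi> c" if g: "g \<in> carrier G" for g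
    proof -
      have "c \<otimes> g \<otimes> inv c \<otimes> inv g \<in> N"
        unfolding N_def lower_central.simps using Suc g by (intro generate.incl) blast
      hence "\<pi> (c \<otimes> g \<otimes> inv c \<otimes> inv g) = \<one>\<^bsub>G Mod N\<^esub>"
        by (subst one) (use g cc in simp_all)
      moreover have "c \<otimes> g = (c \<otimes> g \<otimes> inv c \<otimes> inv g) \<otimes> (g \<otimes> c)"
        using g cc by (simp add: m_assoc inv_solve_left')
      hence "\<pi> (c \<otimes> g) = \<pi> (c \<otimes> g \<otimes> inv c \<otimes> inv g) \<otimes>\<^bsub>G Mod N\<^esub> \<pi> (g \<otimes> c)"
        using \<pi>.hom_mult[of "c \<otimes> g \<otimes> inv c \<otimes> inv g" "g \<otimes> c"] g cc by (simp only: m_closed inv_closed)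
      ultimately have "\<pi> (c \<otimes> g) = \<pi> (g \<otimes> c)" using g cc by (simp only: Q.l_one \<pi>.hom_closed m_closed)
      thus ?thesis using g cc by (simp only: \<pi>.hom_mult)
    qed
    have "\<pi> c = \<one>\<^bsub>G Mod N\<^esub>"
    proof (rule Q.central_commutator_eq_one[of "\<pi> x" "\<pi> y" _ m n])
      show "\<pi> x \<otimes>\<^bsub>G Mod N\<^esub> \<pi> y = \<pi> c \<otimes>\<^bsub>G Mod N\<^esub> (\<pi> y \<otimes>\<^bsub>G Mod N\<^esub> \<pi> x)"
        using arg_cong[OF cxy, of \<pi>] xy cc by (simp only: \<pi>.hom_mult m_closed)
      show "\<pi> x [^]\<^bsub>G Mod N\<^esub> m = \<one>\<^bsub>G Mod N\<^esub>" "\<pi> y [^]\<^bsub>G Mod N\<^esub> n = \<one>\<^bsub>G Mod N\<^esub>"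
        using m n xy \<pi>.hom_nat_pow[of x m] \<pi>.hom_nat_pow[of y n] by simp_all
    qed (use xy cc com cop in auto)
    thus ?case using one[OF cc] by (simp add: N_def)
  qed (use cc in simp)
  hence "c = \<one>" using nil by blast
  thus ?thesis using cxy xy by simp
qed

text \<open>A Sylow \<open>l\<close>-subgroup consists of elements of order coprime to that of
  \<open>x\<close>, so it lies in the centralizer, which therefore contains the full
  \<open>l\<close>-part of the group order.\<close>

lemma centr_prime_power_index:
  assumes nil: "lower_central G k = {\<one>}" and fin: "finite (carrier G)"
    and x: "x \<in> carrier G" "x [^] (p ^ e) = \<one>" and l: "prime l" "l \<noteq> p" "prime p"
    and s: "card (carrier G) = card (centr G {x}) * s"
  shows "\<not> l dvd s"
proof
  assume "l dvd s"
  define a where "a = multiplicity l (card (carrier G))"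
  have pos: "card (carrier G) > 0" using fin one_closed by (metis card_gt_0_iff empty_iff)
  obtain m where m: "card (carrier G) = l ^ a * m" using multiplicity_dvd[of l "card (carrier G)"] by (auto simp: a_def)
  obtain S where S: "subgroup S G" "card S = l ^ a"
    using sylow_thm[of l G a m] l m fin group_axioms by (auto simp: Coset.order_def)
  have "S \<subseteq> centr G {x}"
  proof
    fix y assume y: "y \<in> S"
    have yc: "y \<in> carrier G" using y S subgroup.subset by blast
    interpret SG: group "G\<lparr>carrier := S\<rparr>" using S by (simp add: subgroup_imp_group)
    have "y [^]\<^bsub>G\<lparr>carrier := S\<rparr>\<^esub> Coset.order (G\<lparr>carrier := S\<rparr>) = \<one>\<^bsub>G\<lparr>carrier := S\<rparr>\<^esub>"
      using y by (intro SG.pow_order_eq_1) simp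
    hence "y [^] (l ^ a) = \<one>" using S by (simp add: Coset.order_def nat_pow_consistent[symmetric])
    moreover have "coprime (p ^ e) (l ^ a)" using l by (simp add: primes_coprime)
    ultimately have "x \<otimes> y = y \<otimes> x" using coprime_order_commute[OF nil x(1) yc x(2)] by blast
    thus "y \<in> centr G {x}" using yc by (simp add: centr_def)
  qed
  hence "l ^ a dvd card (centr G {x})"
    using card_subgroup_dvd[OF S(1) centr_subgroup _ fin, of "{x}"] S(2) x by simp
  hence "l ^ a * l dvd card (carrier G)" using \<open>l dvd s\<close> unfolding s by (rule mult_dvd_mono)
  hence "l ^ Suc a dvd card (carrier G)" by (simp add: mult.commute)
  hence "Suc a \<le> a" unfolding a_def using pos l by (intro multiplicity_geI) (auto simp: prime_gt_1_nat)
  thus False by simp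
qed

text \<open>If a Sylow \<open>p\<close>-subgroup were central, the index of the center would be
  prime to \<open>p\<close>.\<close>

lemma noncentral_prime_power_element:
  assumes fin: "finite (carrier G)" and p: "prime p" and t: "card (carrier G) = card (center G) * t" "p dvd t"
  shows "\<exists>x e. x \<in> carrier G - center G \<and> x [^] (p ^ e :: nat) = \<one>"
proof -
  define a where "a = multiplicity p (card (carrier G))"
  have pos: "card (carrier G) > 0" using fin one_closed by (metis card_gt_0_iff empty_iff)
  obtain m where m: "card (carrier G) = p ^ a * m" using multiplicity_dvd[of p "card (carrier G)"] by (auto simp: a_def)
  obtain S where S: "subgroup S G" "card S = p ^ a"
    using sylow_thm[of p G a m] p m fin group_axioms by (auto simp: Coset.order_def)
  have "\<not> S \<subseteq> center G"
  proof
    assume "S \<subseteq> center G"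
    hence "p ^ a dvd card (center G)"
      using card_subgroup_dvd[OF S(1) _ _ fin, of "center G"] S(2) centr_subgroup[of "carrier G"]
      by (simp add: center_eq_centr)
    hence "p ^ a * p dvd card (carrier G)" unfolding t(1) using t(2) by (rule mult_dvd_mono)
    hence "p ^ Suc a dvd card (carrier G)" by (simp add: mult.commute)
    hence "Suc a \<le> a" unfolding a_def using pos p by (intro multiplicity_geI) (auto simp: prime_gt_1_nat)
    thus False by simp
  qed
  then obtain y where y: "y \<in> S" "y \<notin> center G" by blast
  interpret SG: group "G\<lparr>carrier := S\<rparr>" using S by (simp add: subgroup_imp_group)
  have "y [^]\<^bsub>G\<lparr>carrier := S\<rparr>\<^esub> Coset.order (G\<lparr>carrier := S\<rparr>) = \<one>\<^bsub>G\<lparr>carrier := S\<rparr>\<^esub>"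
    using y by (intro SG.pow_order_eq_1) simp
  hence "y [^] (p ^ a) = \<one>" using S by (simp add: Coset.order_def nat_pow_consistent[symmetric])
  moreover have "y \<in> carrier G" using y(1) subgroup.subset[OF S(1)] by blast
  ultimately show ?thesis using y(2) by blast
qed

text \<open>If two primes divide the index of the center, non-central elements of the corresponding
  prime power orders exist, and no prime can divide both of their class sizes.\<close>

lemma center_index_cases:
  assumes nil: "lower_central G k = {\<one>}" and fin: "finite (carrier G)"
  shows "(\<exists>p N. prime p \<and> card (carrier G) = card (center G) * p ^ N) \<or>
    (\<exists>a b s t. a \<in> carrier G - center G \<and> b \<in> carrier G - center G \<and>
      card (carrier G) = card (centr G {a}) * s \<and> card (carrier G) = card (centr G {b}) * t \<and> coprime s t)"
proof -
  have sc: "subgroup (center G) G" unfolding center_eq_centr by (rule centr_subgroup) simp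
  obtain n where n: "card (carrier G) = card (center G) * n"
    using card_subgroup_dvd[OF sc subgroup_self _ fin] subgroup.subset[OF sc] by (auto elim: dvdE)
  have pos: "card (carrier G) > 0" using fin one_closed by (metis card_gt_0_iff empty_iff)
  hence n0: "n > 0" using n by (cases n) auto
  show ?thesis
  \<comment> \<open>The first case includes index 1, where any prime serves with exponent 0.\<close>
  proof (cases "\<exists>p. prime p \<and> (\<forall>q. prime q \<longrightarrow> q dvd n \<longrightarrow> q = p)")
    case True
    then obtain p where p: "prime p" "\<And>q. prime q \<Longrightarrow> q dvd n \<Longrightarrow> q = p" by blast
    have "n \<noteq> 0" "\<not> is_unit p" using n0 p(1) by auto
    from multiplicity_decompose'[OF this] obtain r m where m: "n = p ^ r * m" "\<not> p dvd m" by blast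
    have "m = 1"
    proof (rule ccontr)
      assume "m \<noteq> 1"
      then obtain q where q: "prime q" "q dvd m" using prime_factor_nat by blast
      hence "q dvd n" unfolding m(1) by (intro dvd_mult)
      thus False using p(2) q m(2) by blast
    qed
    hence "n = p ^ r" using m(1) by simp
    hence "prime p \<and> card (carrier G) = card (center G) * p ^ r" using n p(1) by simp
    thus ?thesis by blast
  next
    case False
    hence ex: "\<exists>q. prime q \<and> q dvd n \<and> q \<noteq> p" if "prime p" for p using that by blast
    obtain p where p: "prime p" "p dvd n" using ex[OF two_is_prime_nat] by auto
    obtain q where q: "prime q" "q dvd n" "q \<noteq> p" using ex[OF p(1)] by auto
    obtain a e where a: "a \<in> carrier G - center G" "a [^] (p ^ e :: nat) = \<one>"
      using noncentral_prime_power_element[OF fin p(1) n p(2)] by blast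
    obtain b e' where b: "b \<in> carrier G - center G" "b [^] (q ^ e' :: nat) = \<one>"
      using noncentral_prime_power_element[OF fin q(1) n q(2)] by blast
    have ix: "\<exists>s. card (carrier G) = card (centr G {x}) * s" if "x \<in> carrier G" for x
    proof -
      have "card (centr G {x}) dvd card (carrier G)"
        by (rule card_subgroup_dvd[OF centr_subgroup subgroup_self _ fin])
          (use that in \<open>simp_all add: centr_def\<close>)
      thus ?thesis unfolding dvd_def .
    qed
    have ab: "a \<in> carrier G" "b \<in> carrier G" using a b by auto
    obtain s where s: "card (carrier G) = card (centr G {a}) * s" using ix[OF ab(1)] by (rule exE)
    obtain t where t: "card (carrier G) = card (centr G {b}) * t" using ix[OF ab(2)] by (rule exE)
    note st = s t
    have "coprime s t"
    proof (rule ccontr)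
      assume "\<not> coprime s t"
      hence "gcd s t \<noteq> 1" unfolding coprime_iff_gcd_eq_1 .
      then obtain l where l: "prime l" "l dvd gcd s t" using prime_factor_nat by blast
      hence ls: "l dvd s" "l dvd t" by auto
      have "l = p"
        using centr_prime_power_index[OF nil fin ab(1) a(2) l(1) _ p(1) st(1)] ls by blast
      moreover have "l = q"
        using centr_prime_power_index[OF nil fin ab(2) b(2) l(1) _ q(1) st(2)] ls by blast
      ultimately show False using q by simp
    qed
    hence "\<exists>a b s t. a \<in> carrier G - center G \<and> b \<in> carrier G - center G \<and>
      card (carrier G) = card (centr G {a}) * s \<and> card (carrier G) = card (centr G {b}) * t \<and> coprime s t"
      using a(1) b(1) st by (intro exI conjI)
    thus ?thesis by (rule disjI2)
  qed
qed

end

section \<open>Non-commuting graphs\<close>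

lemma graph_iso_sym: "graph_iso V E W F \<Longrightarrow> graph_iso W F V E"
  unfolding graph_iso_def
proof (elim exE conjE)
  fix f assume f: "bij_betw f V W" "\<forall>x\<in>V. \<forall>y\<in>V. E x y = F (f x) (f y)"
  let ?g = "the_inv_into V f"
  have g: "bij_betw ?g W V" by (rule bij_betw_the_inv_into[OF f(1)])
  moreover have "f (?g w) = w" if "w \<in> W" for w
    using f(1) that by (auto simp: bij_betw_def f_the_inv_into_f)
  moreover have "?g w \<in> V" if "w \<in> W" for w using g that by (rule bij_betw_apply)
  ultimately show "\<exists>g. bij_betw g W V \<and> (\<forall>x\<in>W. \<forall>y\<in>W. F x y = E (g x) (g y))"
    using f(2) by (intro exI[of _ ?g]) simp
qed

text \<open>A vertex centralizes a set of vertices iff it is adjacent to none of them, so the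
  isomorphism respects the non-central parts of centralizers. Subtracting the orders of the centers
  leaves the sizes of these parts.\<close>

lemma graph_iso_centralizers:
  assumes G: "group G" "finite (carrier G)" and H: "group H" "finite (carrier H)"
    and iso: "graph_iso (nc_vertices G) (nc_adj G) (nc_vertices H) (nc_adj H)"
  obtains f where "\<And>x. x \<in> nc_vertices G \<Longrightarrow> f x \<in> nc_vertices H"
    and "\<And>S. S \<subseteq> nc_vertices G \<Longrightarrow>
      int (card (centr G S)) - int (card (center G)) = int (card (centr H (f ` S))) - int (card (center H))"
proof -
  obtain f where bij: "bij_betw f (nc_vertices G) (nc_vertices H)"
    and adj: "\<And>x y. x \<in> nc_vertices G \<Longrightarrow> y \<in> nc_vertices G \<Longrightarrow> nc_adj G x y = nc_adj H (f x) (f y)"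
    using iso by (auto simp: graph_iso_def)
  have split: "int (card (centr K S)) - int (card (center K)) = int (card (centr K S \<inter> nc_vertices K))"
    if "group K" "finite (carrier K)" "S \<subseteq> nc_vertices K" for K :: "('x, 'y) monoid_scheme" and S
  proof -
    have "S \<subseteq> carrier K" using that by (auto simp: nc_vertices_def)
    hence "center K \<subseteq> centr K S" using group.center_subset_centr[OF that(1)] by blast
    moreover have "centr K S \<subseteq> carrier K" by (auto simp: centr_def)
    ultimately have "centr K S = center K \<union> (centr K S \<inter> nc_vertices K)" by (auto simp: nc_vertices_def)
    moreover have "finite (center K)" "finite (centr K S)"
      using that(2) by (auto simp: center_def centr_def)
    ultimately have "card (centr K S) = card (center K) + card (centr K S \<inter> nc_vertices K)"
      by (subst card_Un_disjoint[symmetric]) (auto simp: nc_vertices_def)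
    thus ?thesis by simp
  qed
  have mem: "y \<in> centr K S \<longleftrightarrow> (\<forall>s\<in>S. \<not> nc_adj K s y)"
    if "S \<subseteq> nc_vertices K" "y \<in> nc_vertices K" for K :: "('x, 'y) monoid_scheme" and S y
    using that by (auto simp: centr_def nc_adj_def nc_vertices_def)
  show ?thesis
  proof (rule that)
    show fV: "f x \<in> nc_vertices H" if "x \<in> nc_vertices G" for x
      using bij that by (rule bij_betw_apply)
    fix S assume S: "S \<subseteq> nc_vertices G"
    have fS: "f ` S \<subseteq> nc_vertices H" using S fV by auto
    have iff: "f y \<in> centr H (f ` S) \<longleftrightarrow> y \<in> centr G S" if "y \<in> nc_vertices G" for y
      using mem[OF S that] mem[OF fS fV[OF that]] adj S that by auto
    have "f ` (centr G S \<inter> nc_vertices G) = centr H (f ` S) \<inter> nc_vertices H"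
    proof
      show "f ` (centr G S \<inter> nc_vertices G) \<subseteq> centr H (f ` S) \<inter> nc_vertices H"
        using iff fV by auto
      show "centr H (f ` S) \<inter> nc_vertices H \<subseteq> f ` (centr G S \<inter> nc_vertices G)"
      proof
        fix w assume w: "w \<in> centr H (f ` S) \<inter> nc_vertices H"
        then obtain y where "y \<in> nc_vertices G" "w = f y" using bij by (auto simp: bij_betw_def)
        thus "w \<in> f ` (centr G S \<inter> nc_vertices G)" using w iff by auto
      qed
    qed
    moreover have "inj_on f (centr G S \<inter> nc_vertices G)"
      using bij by (auto simp: bij_betw_def intro: inj_on_subset)
    ultimately have "card (centr G S \<inter> nc_vertices G) = card (centr H (f ` S) \<inter> nc_vertices H)"
      using card_image by fastforce
    thus "int (card (centr G S)) - int (card (center G)) = int (card (centr H (f ` S))) - int (card (center H))"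
      using split[OF G S] split[OF H fS] by simp
  qed
qed

section \<open>Central quotients that are not of prime power order\<close>

text \<open>Differences eliminate \<open>d\<close>, and comparing them eliminates \<open>W\<close>.
  What remains is \<open>k (q ^ (b - w) - 1) = q ^ (M - w) - q ^ (a - w)\<close> with positive
  exponents, so \<open>q\<close> divides \<open>k\<close>. This holds for both \<open>k = s\<close>
  and \<open>k = t\<close>.\<close>

lemma prime_power_index_impossible:
  fixes W s t z q :: nat
  assumes q: "prime q" and z: "z > 0" and W: "W > 0" and st: "s > 1" "t > 1" "coprime s t"
    and e: "int (W * t) - int (z * q ^ \<alpha>) = d" "int (W * s) - int (z * q ^ \<beta>) = d"
      "int (W * s * t) - int (z * q ^ M) = d" "int W - int (z * q ^ w) = d"
  shows False
proof -
  have q1: "int q > 1" using prime_gt_1_nat[OF q] by simp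
  have key: "q dvd k" if k: "k > 1" and l: "l > 1"
    and eq: "int (W * k) - int (z * q ^ a) = d" "int (W * l) - int (z * q ^ b) = d" "int (W * k * l) - int (z * q ^ M) = d"
    for k l a b
  proof -
    have zq: "int z * int q ^ a = int W * int k - d" "int z * int q ^ b = int W * int l - d"
      "int z * int q ^ M = int W * int k * int l - d" "int z * int q ^ w = int W - d"
      using eq e(4) by simp_all
    have aw: "int z * (int q ^ a - int q ^ w) = int W * (int k - 1)"
      and bw: "int z * (int q ^ b - int q ^ w) = int W * (int l - 1)"
      and Ma: "int z * (int q ^ M - int q ^ a) = int W * int k * (int l - 1)"
      unfolding right_diff_distrib zq by simp_all
    have lt: "i < j" if "int z * (int q ^ j - int q ^ i) > 0" for i j
    proof -
      have "int q ^ i < int q ^ j" using that z by (simp add: zero_less_mult_iff)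
      thus ?thesis using q1 by (simp add: power_strict_increasing_iff)
    qed
    have wa: "w < a" and wb: "w < b" and aM: "a < M"
      by (rule lt, unfold aw bw Ma, use W k l in simp)+
    have "int k * (int z * (int q ^ b - int q ^ w)) = int z * (int q ^ M - int q ^ a)"
      unfolding bw Ma by simp
    hence "int z * (int k * (int q ^ b - int q ^ w)) = int z * (int q ^ M - int q ^ a)"
      by (simp only: mult.left_commute)
    hence "int k * (int q ^ b - int q ^ w) = int q ^ M - int q ^ a" using z by simp
    moreover have "int q ^ b = int q ^ w * int q ^ (b - w)" "int q ^ M = int q ^ w * int q ^ (M - w)"
      "int q ^ a = int q ^ w * int q ^ (a - w)"
      using wa wb aM by (simp_all flip: power_add)
    ultimately have "int q ^ w * (int k * (int q ^ (b - w) - 1)) = int q ^ w * (int q ^ (M - w) - int q ^ (a - w))"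
      by (simp add: algebra_simps)
    hence "int k * (int q ^ (b - w) - 1) = int q ^ (M - w) - int q ^ (a - w)" using q1 by simp
    hence "int k = int k * int q ^ (b - w) - int q ^ (M - w) + int q ^ (a - w)" by (simp add: algebra_simps)
    moreover have "int q dvd int k * int q ^ (b - w) - int q ^ (M - w) + int q ^ (a - w)"
      using wa wb aM by (intro dvd_add dvd_diff dvd_mult dvd_power) auto
    ultimately have "int q dvd int k" by (simp only:)
    thus ?thesis by simp
  qed
  have "q dvd t" by (rule key[of t s \<alpha> \<beta>]) (use e st in \<open>simp_all add: mult_ac\<close>)
  moreover have "q dvd s" by (rule key[of s t \<beta> \<alpha>]) (use e st in simp_all)
  ultimately have "q dvd 1" using coprime_common_divisor[OF st(3)] by blast
  thus False using prime_gt_1_nat[OF q] by simp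
qed

lemma vertex_centralizer_bounds:
  assumes "group G" "finite (carrier G)" "x \<in> nc_vertices G"
  shows "card (center G) < card (centr G {x})" "card (centr G {x}) < card (carrier G)"
proof -
  interpret group G by fact
  have x: "x \<in> carrier G" "x \<notin> center G" using assms(3) by (auto simp: nc_vertices_def)
  have "finite (centr G {x})" using assms(2) by (simp add: centr_def)
  moreover have "x \<in> centr G {x}" using x by (auto simp: centr_def)
  ultimately show "card (center G) < card (centr G {x})"
    using center_subset_centr[of "{x}"] x by (intro psubset_card_mono) auto
  show "card (centr G {x}) < card (carrier G)"
    using x by (intro psubset_card_mono[OF assms(2)]) (auto simp: centr_def center_def)
qed

text \<open>Let \<open>k\<close> and \<open>l\<close> be the orders of the two centralizers divided
  by \<open>W\<close>. From \<open>k s = l t\<close> and coprimality \<open>k = t k'\<close> and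
  \<open>l = s k'\<close>, and \<open>card_mult_le\<close> leaves only
  \<open>k' = 1\<close>.\<close>

lemma (in group) coprime_index_centralizers:
  assumes fin: "finite (carrier G)" and ab: "a \<in> carrier G - center G" "b \<in> carrier G - center G"
    and st: "card (carrier G) = card (centr G {a}) * s" "card (carrier G) = card (centr G {b}) * t" "coprime s t"
  defines "W \<equiv> card (centr G {a, b})"
  shows "W > 0" "s > 1" "t > 1" "card (centr G {a}) = W * t" "card (centr G {b}) = W * s"
    "card (carrier G) = W * s * t"
proof -
  have abc: "a \<in> carrier G" "b \<in> carrier G" using ab by auto
  have sg: "subgroup (centr G {a}) G" "subgroup (centr G {b}) G" "subgroup (centr G {a, b}) G"
    using abc by (auto intro!: centr_subgroup)
  have WI: "W = card (centr G {a} \<inter> centr G {b})"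
    unfolding W_def using centr_Un[of "{a}" "{b}"] by (simp add: insert_commute)
  show W0: "W > 0" unfolding W_def using sg fin by (intro card_subgroup_pos)
  have g0: "card (carrier G) > 0" by (rule card_subgroup_pos[OF subgroup_self fin])
  have proper: "card (centr G {x}) < card (carrier G)" if "x \<in> carrier G - center G" for x
    by (rule vertex_centralizer_bounds(2)[OF is_group fin]) (use that in \<open>simp add: nc_vertices_def\<close>)
  have gt1: "n > 1" if "card (carrier G) = m * n" "m < card (carrier G)" for m n :: nat
  proof (rule ccontr)
    assume "\<not> n > 1"
    hence "m * n \<le> m * 1" by (intro mult_left_mono) auto
    thus False using that by simp
  qed
  show s1: "s > 1" by (rule gt1[OF st(1) proper[OF ab(1)]])
  show t1: "t > 1" by (rule gt1[OF st(2) proper[OF ab(2)]])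
  have sub: "centr G {a, b} \<subseteq> centr G {a}" "centr G {a, b} \<subseteq> centr G {b}" by (auto simp: centr_def)
  obtain k where k: "card (centr G {a}) = W * k"
    using card_subgroup_dvd[OF sg(3,1) sub(1) fin] by (auto simp: W_def)
  obtain l where l: "card (centr G {b}) = W * l"
    using card_subgroup_dvd[OF sg(3,2) sub(2) fin] by (auto simp: W_def)
  have kl: "k * s = l * t" using st(1,2) W0 unfolding k l by simp
  have "coprime t s" using st(3) by (simp add: coprime_commute)
  moreover have "t dvd k * s" unfolding kl by simp
  ultimately have "t dvd k" by (simp add: coprime_dvd_mult_left_iff)
  then obtain k' where k': "k = t * k'" by blast
  have l': "l = k' * s" using kl t1 unfolding k' by simp
  have "card (centr G {a}) * card (centr G {b}) \<le> card (carrier G) * W"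
    unfolding WI by (rule card_mult_le[OF sg(1,2) fin])
  hence "(W * W) * (k * l) \<le> (W * W) * (k * s)" unfolding st(1) k l by (simp add: mult_ac)
  hence "k * l \<le> k * s" using W0 by simp
  moreover have k0: "k > 0" using g0 st(1) unfolding k by (cases k) auto
  ultimately have "k' * s \<le> 1 * s" unfolding l' by simp
  hence "k' \<le> 1" using s1 by simp
  moreover have "k' > 0" using k0 k' by (cases k') auto
  ultimately have "k' = 1" by simp
  show "card (centr G {a}) = W * t" "card (centr G {b}) = W * s" "card (carrier G) = W * s * t"
    using k l k' l' st(1) \<open>k' = 1\<close> by simp_all
qed

text \<open>The left side minus the right side is \<open>d W (s - 1) (t - 1)\<close>.\<close>

lemma coprime_index_le:
  fixes W s t g :: int
  assumes "W > 0" "s > 1" "t > 1" and le: "(W * t - d) * (W * s - d) \<le> (W * s * t - d) * (W - d)"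
  shows "d \<le> 0"
proof (rule ccontr)
  assume "\<not> d \<le> 0"
  hence "d * (W * ((s - 1) * (t - 1))) > 0" using assms by simp
  thus False using le by (simp add: algebra_simps)
qed

lemma card_centr_eq_center_times_power:
  assumes "group G" "finite (carrier G)" "prime p" "card (carrier G) = card (center G) * p ^ N" "S \<subseteq> carrier G"
  shows "\<exists>i. card (centr G S) = card (center G) * p ^ i"
proof -
  interpret group G by fact
  have sg: "subgroup (center G) G" "subgroup (centr G S) G"
    using assms(5) by (auto simp: center_eq_centr intro!: centr_subgroup)
  obtain m where m: "card (centr G S) = card (center G) * m"
    using card_subgroup_dvd[OF sg center_subset_centr[OF assms(5)] assms(2)] by blast
  have "card (centr G S) dvd card (carrier G)"
    using card_subgroup_dvd[OF sg(2) subgroup_self _ assms(2)] subgroup.subset[OF sg(2)] by blast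
  hence "m dvd p ^ N" using card_subgroup_pos[OF sg(1) assms(2)] unfolding m assms(4) by simp
  thus ?thesis using m divides_primepow_nat[OF assms(3)] by auto
qed

text \<open>The isomorphism shifts the four orders \<open>W\<close>, \<open>W t\<close>,
  \<open>W s\<close> and \<open>W s t\<close> by the same \<open>d\<close>. For the second claim,
  \<open>card_mult_le\<close> in \<open>H\<close> becomes the inequality of
  \<open>coprime_index_le\<close>.\<close>

lemma mixed_case_impossible:
  assumes G: "group G" "finite (carrier G)" and H: "group H" "finite (carrier H)"
    and iso: "graph_iso (nc_vertices G) (nc_adj G) (nc_vertices H) (nc_adj H)"
    and ab: "a \<in> carrier G - center G" "b \<in> carrier G - center G"
    and st: "card (carrier G) = card (centr G {a}) * s" "card (carrier G) = card (centr G {b}) * t" "coprime s t"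
  shows "\<not> (prime q \<and> card (carrier H) = card (center H) * q ^ M)"
    and "card (center G) \<le> card (center H)"
proof -
  interpret G: group G by fact
  interpret H: group H by fact
  obtain f where fV: "\<And>x. x \<in> nc_vertices G \<Longrightarrow> f x \<in> nc_vertices H"
    and f: "\<And>S. S \<subseteq> nc_vertices G \<Longrightarrow>
      int (card (centr G S)) - int (card (center G)) = int (card (centr H (f ` S))) - int (card (center H))"
    using graph_iso_centralizers[OF G H iso] by metis
  have V: "a \<in> nc_vertices G" "b \<in> nc_vertices G" using ab by (auto simp: nc_vertices_def)
  have Vc: "f a \<in> carrier H" "f b \<in> carrier H" using fV[OF V(1)] fV[OF V(2)] by (auto simp: nc_vertices_def)
  define W where "W = card (centr G {a, b})"
  note c = G.coprime_index_centralizers[OF G(2) ab st, folded W_def]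
  define d where "d = int (card (center G)) - int (card (center H))"
  have e: "int (W * t) - int (card (centr H {f a})) = d" "int (W * s) - int (card (centr H {f b})) = d"
    "int (W * s * t) - int (card (carrier H)) = d" "int W - int (card (centr H {f a, f b})) = d"
    using f[of "{a}"] f[of "{b}"] f[of "{}"] f[of "{a, b}"] V c(4,5,6)
    by (simp_all add: d_def G.centr_empty H.centr_empty W_def[symmetric])
  show "\<not> (prime q \<and> card (carrier H) = card (center H) * q ^ M)"
  proof
    assume q: "prime q \<and> card (carrier H) = card (center H) * q ^ M"
    have ex: "\<exists>i. card (centr H S) = card (center H) * q ^ i" if "S \<subseteq> carrier H" for S
      using card_centr_eq_center_times_power[OF H] q that by blast
    obtain i j w where ijw: "card (centr H {f a}) = card (center H) * q ^ i"
      "card (centr H {f b}) = card (center H) * q ^ j" "card (centr H {f a, f b}) = card (center H) * q ^ w"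
      using ex[of "{f a}"] ex[of "{f b}"] ex[of "{f a, f b}"] Vc by auto
    have "subgroup (center H) H" unfolding H.center_eq_centr by (rule H.centr_subgroup) simp
    hence z: "card (center H) > 0" using H.card_subgroup_pos H by blast
    note e' = e[unfolded ijw conjunct2[OF q]]
    show False
      by (rule prime_power_index_impossible[OF conjunct1[OF q] z c(1,2,3) st(3) e'])
  qed
  have sg: "subgroup (centr H {f a}) H" "subgroup (centr H {f b}) H"
    using Vc by (auto intro!: H.centr_subgroup)
  have "card (centr H {f a}) * card (centr H {f b}) \<le> card (carrier H) * card (centr H {f a, f b})"
    using H.card_mult_le[OF sg H(2)] H.centr_Un[of "{f a}" "{f b}"] by (simp add: insert_commute)
  hence le: "int (card (centr H {f a})) * int (card (centr H {f b})) \<le> int (card (carrier H)) * int (card (centr H {f a, f b}))"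
    by (simp flip: of_nat_mult)
  have r: "int (card (centr H {f a})) = int W * int t - d" "int (card (centr H {f b})) = int W * int s - d"
    "int (card (carrier H)) = int W * int s * int t - d" "int (card (centr H {f a, f b})) = int W - d"
    using e by simp_all
  have "(int W * int t - d) * (int W * int s - d) \<le> (int W * int s * int t - d) * (int W - d)"
    by (rule le[unfolded r])
  hence "d \<le> 0" by (rule coprime_index_le[rotated -1]) (use c in auto)
  thus "card (center G) \<le> card (center H)" by (simp add: d_def)
qed

text \<open>The degree of a vertex is the group order minus that of its centralizer, so unequal
  degrees mean unequal centralizer orders.\<close>

lemma irregular_centralizers:
  assumes G: "group G" "finite (carrier G)" and irr: "\<not> regular_graph (nc_vertices G) (nc_adj G)"
  obtains x y where "x \<in> nc_vertices G" "y \<in> nc_vertices G" "card (centr G {x}) < card (centr G {y})"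
proof -
  have deg: "Defs.degree (nc_vertices G) (nc_adj G) x = card (carrier G) - card (centr G {x})"
    if x: "x \<in> nc_vertices G" for x
  proof -
    have "{w \<in> nc_vertices G. nc_adj G x w} = carrier G - centr G {x}"
      using x by (auto simp: nc_vertices_def nc_adj_def centr_def center_def) metis+
    moreover have "centr G {x} \<subseteq> carrier G" by (auto simp: centr_def)
    ultimately show ?thesis using G(2) by (simp add: Defs.degree_def card_Diff_subset finite_subset)
  qed
  obtain x y where xy: "x \<in> nc_vertices G" "y \<in> nc_vertices G"
    "Defs.degree (nc_vertices G) (nc_adj G) x \<noteq> Defs.degree (nc_vertices G) (nc_adj G) y"
    using irr by (auto simp: regular_graph_def)
  hence "card (centr G {x}) \<noteq> card (centr G {y})" by (auto simp: deg)
  thus ?thesis using that xy by (metis linorder_neqE_nat)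
qed

theorem theorem1:
  fixes G :: "('a, 'c) monoid_scheme" and H :: "('b, 'd) monoid_scheme"
  assumes "group G" and "group H"
    and "finite (carrier G)" and "finite (carrier H)"
    and "nilpotent_group G" and "nilpotent_group H"
    and "nonabelian G" and "nonabelian H"
    and "\<not> regular_graph (nc_vertices G) (nc_adj G)"
    and "\<not> regular_graph (nc_vertices H) (nc_adj H)"
    and "graph_iso (nc_vertices G) (nc_adj G) (nc_vertices H) (nc_adj H)"
  shows "card (carrier G) = card (carrier H)"
proof -
  interpret G: group G by fact
  interpret H: group H by fact
  note fin = assms(3,4)
  note iso = assms(11) and iso' = graph_iso_sym[OF assms(11)]
  obtain f where fV: "\<And>x. x \<in> nc_vertices G \<Longrightarrow> f x \<in> nc_vertices H"
    and f: "\<And>S. S \<subseteq> nc_vertices G \<Longrightarrow>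
      int (card (centr G S)) - int (card (center G)) = int (card (centr H (f ` S))) - int (card (center H))"
    using graph_iso_centralizers[OF assms(1,3,2,4) iso] by metis
  have total: "int (card (carrier G)) - int (card (center G)) = int (card (carrier H)) - int (card (center H))"
    using f[of "{}"] by (simp add: G.centr_empty H.centr_empty)
  obtain k k' where nil: "lower_central G k = {\<one>\<^bsub>G\<^esub>}" "lower_central H k' = {\<one>\<^bsub>H\<^esub>}"
    using assms(5,6) by (auto simp: nilpotent_group_def)
  note casesG = G.center_index_cases[OF nil(1) fin(1)] and casesH = H.center_index_cases[OF nil(2) fin(2)]
  have "card (center G) = card (center H)"
  proof (cases "\<exists>p N. prime p \<and> card (carrier G) = card (center G) * p ^ N")
    case True
    then obtain p N where p: "prime p" "card (carrier G) = card (center G) * p ^ N" by blast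
    have "\<exists>q M. prime q \<and> card (carrier H) = card (center H) * q ^ M"
    proof (rule ccontr)
      assume "\<not> ?thesis"
      then obtain a b s t where "a \<in> carrier H - center H" "b \<in> carrier H - center H"
        "card (carrier H) = card (centr H {a}) * s" "card (carrier H) = card (centr H {b}) * t" "coprime s t"
        using casesH by blast
      from mixed_case_impossible(1)[OF assms(2,4,1,3) iso' this] p show False by blast
    qed
    then obtain q M where q: "prime q" "card (carrier H) = card (center H) * q ^ M" by blast
    obtain x y where xy: "x \<in> nc_vertices G" "y \<in> nc_vertices G" "card (centr G {x}) < card (centr G {y})"
      using irregular_centralizers[OF assms(1,3,9)] .
    have c: "x \<in> carrier G" "y \<in> carrier G" "f x \<in> carrier H" "f y \<in> carrier H"
      using xy fV[OF xy(1)] fV[OF xy(2)] by (auto simp: nc_vertices_def)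
    have exG: "\<exists>i. card (centr G {v}) = card (center G) * p ^ i" if "v \<in> carrier G" for v
      using card_centr_eq_center_times_power[OF assms(1,3) p, of "{v}"] that by simp
    have exH: "\<exists>i. card (centr H {v}) = card (center H) * q ^ i" if "v \<in> carrier H" for v
      using card_centr_eq_center_times_power[OF assms(2,4) q, of "{v}"] that by simp
    obtain i i' where i: "card (centr G {x}) = card (center G) * p ^ i" "card (centr G {y}) = card (center G) * p ^ i'"
      using exG[OF c(1)] exG[OF c(2)] by blast
    obtain j j' where j: "card (centr H {f x}) = card (center H) * q ^ j" "card (centr H {f y}) = card (center H) * q ^ j'"
      using exH[OF c(3)] exH[OF c(4)] by blast
    \<comment> \<open>The three relations come from the sets \<open>{x}\<close>, \<open>{y}\<close>
      and the empty set.\<close>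
    have eqs: "int (card (center G)) * (int p ^ i - 1) = int (card (center H)) * (int q ^ j - 1)"
      "int (card (center G)) * (int p ^ i' - 1) = int (card (center H)) * (int q ^ j' - 1)"
      "int (card (center G)) * (int p ^ N - 1) = int (card (center H)) * (int q ^ M - 1)"
      using f[of "{x}"] f[of "{y}"] total xy unfolding p(2) q(2) by (simp_all add: i j right_diff_distrib)
    have z: "card (center G) > 0" "card (center H) > 0"
      using G.card_subgroup_pos[OF _ fin(1), of "center G"] G.centr_subgroup[of "carrier G"]
        H.card_subgroup_pos[OF _ fin(2), of "center H"] H.centr_subgroup[of "carrier H"]
      by (simp_all add: G.center_eq_centr H.center_eq_centr)
    have lt: "k < l" if "m * r ^ k < m * r ^ l" "r > 1" for m r k l :: nat
      using that by (simp add: power_strict_increasing_iff)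
    have pq: "p > 1" "q > 1" using p q prime_gt_1_nat by auto
    note bG = vertex_centralizer_bounds[OF assms(1,3)] and bH = vertex_centralizer_bounds[OF assms(2,4)]
    have "card (centr H {f x}) < card (centr H {f y})"
      using f[of "{x}"] f[of "{y}"] xy by simp
    \<comment> \<open>In both groups the orders of the center, the two centralizers and the group
      increase strictly; irregularity is what separates the two centralizers.\<close>
    hence ij: "0 < i" "i < i'" "i' < N" "0 < j" "j < j'" "j' < M"
      using lt[of "card (center G)" p 0 i] lt[of "card (center G)" p i i'] lt[of "card (center G)" p i' N]
        lt[of "card (center H)" q 0 j] lt[of "card (center H)" q j j'] lt[of "card (center H)" q j' M]
        bG(1)[OF xy(1)] bG(2)[OF xy(2)] bH(1)[OF fV[OF xy(1)]] bH(2)[OF fV[OF xy(2)]] xy(3) pq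
      unfolding i j p(2) q(2) by simp_all
    show ?thesis by (rule prime_power_pairs_eq[OF p(1) q(1) z ij eqs])
  next
    case False
    then obtain a b s t where G': "a \<in> carrier G - center G" "b \<in> carrier G - center G"
      "card (carrier G) = card (centr G {a}) * s" "card (carrier G) = card (centr G {b}) * t" "coprime s t"
      using casesG by blast
    have "\<not> (\<exists>q M. prime q \<and> card (carrier H) = card (center H) * q ^ M)"
      using mixed_case_impossible(1)[OF assms(1,3,2,4) iso G'] by blast
    then obtain a' b' s' t' where H': "a' \<in> carrier H - center H" "b' \<in> carrier H - center H"
      "card (carrier H) = card (centr H {a'}) * s'" "card (carrier H) = card (centr H {b'}) * t'" "coprime s' t'"
      using casesH by blast
    \<comment> \<open>Both groups now have class sizes that are coprime and non-trivial, so the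
      inequality between the centers holds in both directions.\<close>
    show ?thesis
      using mixed_case_impossible(2)[OF assms(1,3,2,4) iso G'] mixed_case_impossible(2)[OF assms(2,4,1,3) iso' H']
      by (rule le_antisym)
  qed
  thus ?thesis using total by simp
qed

end
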